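(* For each tree \(T\) with maximum degree \(\Delta(T)>3\), there exists a 3-connected plane triangulation \(G\) with \(T\) as decomposition tree such that \(G\) is not hamiltonian-connected.
   Context: A plane triangulation is a simple plane graph all of whose faces, including the outer face, are triangles. A separating triangle is a 3-cycle whose removal disconnects the graph. Decomposition tree of a 3-connected triangulation: a triangulation with a separating triangle \(S\) is split into two triangulations, namely the subgraphs inside and outside \(S\), each containing a copy of \(S\). Iterating this on a triangulation with \(k\) separating triangles yields \(k+1\) triangulations without separating triangles (the pieces); these are the vertices of the decomposition tree, and two pieces are adjacent iff they share a separating triangle of the original triangulation. "\(G\) has \(T\) as decomposition tree" means its decomposition tree is isomorphic to \(T\). A graph is hamiltonian-connected if every pair of distinct vertices is joined by a hamiltonian path. *)

theory Defs
  imports "HOL-Analysis.Analysis"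
begin

section \<open>Simple graphs\<close>

record 'a ugraph =
  uverts :: "'a set"
  uedges :: "'a set set"

definition simple_graph :: "'a ugraph \<Rightarrow> bool" where
  "simple_graph G \<longleftrightarrow> finite (uverts G) \<and> (\<forall>e\<in>uedges G. e \<subseteq> uverts G \<and> card e = 2)"

definition adj :: "'a ugraph \<Rightarrow> 'a \<Rightarrow> 'a \<Rightarrow> bool" where
  "adj G u v \<longleftrightarrow> {u, v} \<in> uedges G"

definition vpath :: "'a ugraph \<Rightarrow> 'a \<Rightarrow> 'a list \<Rightarrow> 'a \<Rightarrow> bool" where
  "vpath G u p v \<longleftrightarrow> p \<noteq> [] \<and> hd p = u \<and> last p = v \<and>
     set p \<subseteq> uverts G \<and> distinct p \<and> successively (adj G) p"

definition vcycle :: "'a ugraph \<Rightarrow> 'a list \<Rightarrow> bool" where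
  "vcycle G p \<longleftrightarrow> length p \<ge> 3 \<and> set p \<subseteq> uverts G \<and> distinct p \<and>
     successively (adj G) p \<and> adj G (last p) (hd p)"

definition graph_connected :: "'a ugraph \<Rightarrow> bool" where
  "graph_connected G \<longleftrightarrow> (\<forall>u\<in>uverts G. \<forall>v\<in>uverts G. \<exists>p. vpath G u p v)"

definition del_verts :: "'a ugraph \<Rightarrow> 'a set \<Rightarrow> 'a ugraph" where
  "del_verts G X = \<lparr>uverts = uverts G - X, uedges = {e \<in> uedges G. e \<inter> X = {}}\<rparr>"

definition k_connected :: "nat \<Rightarrow> 'a ugraph \<Rightarrow> bool" where
  "k_connected k G \<longleftrightarrow> card (uverts G) > k \<and>
     (\<forall>X\<subseteq>uverts G. card X < k \<longrightarrow> graph_connected (del_verts G X))"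

definition is_tree :: "'a ugraph \<Rightarrow> bool" where
  "is_tree G \<longleftrightarrow> simple_graph G \<and> uverts G \<noteq> {} \<and> graph_connected G \<and> (\<nexists>p. vcycle G p)"

definition vdegree :: "'a ugraph \<Rightarrow> 'a \<Rightarrow> nat" where
  "vdegree G v = card {e \<in> uedges G. v \<in> e}"

definition max_degree :: "'a ugraph \<Rightarrow> nat" where
  "max_degree G = Max (vdegree G ` uverts G)"

definition graph_iso :: "'a ugraph \<Rightarrow> 'b ugraph \<Rightarrow> bool" where
  "graph_iso G H \<longleftrightarrow> (\<exists>f. bij_betw f (uverts G) (uverts H) \<and> uedges H = (`) f ` uedges G)"

definition hamiltonian_connected :: "'a ugraph \<Rightarrow> bool" where
  "hamiltonian_connected G \<longleftrightarrow>
     (\<forall>u\<in>uverts G. \<forall>v\<in>uverts G. u \<noteq> v \<longrightarrow> (\<exists>p. vpath G u p v \<and> set p = uverts G))"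

text \<open>A 3-cycle of a simple graph is identified with its set of vertices.\<close>

definition is_triangle :: "'a ugraph \<Rightarrow> 'a set \<Rightarrow> bool" where
  "is_triangle G S \<longleftrightarrow> (\<exists>a b c. S = {a, b, c} \<and> vcycle G [a, b, c])"

definition separating_triangle :: "'a ugraph \<Rightarrow> 'a set \<Rightarrow> bool" where
  "separating_triangle G S \<longleftrightarrow> is_triangle G S \<and> \<not> graph_connected (del_verts G S)"


section \<open>Plane graphs\<close>

text \<open>
  The plane is \<^typ>\<open>complex\<close>. The edges of a plane graph are point sets, namely images of
  arcs; the end points of an edge \<open>e\<close> are recovered as \<open>e \<inter> pverts G\<close>. Injectivity of this
  map excludes parallel edges; loops are excluded because an arc has distinct end points.
\<close>

record plane_drawing =
  pverts :: "complex set"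
  pedges :: "complex set set"

definition simple_plane_graph :: "plane_drawing \<Rightarrow> bool" where
  "simple_plane_graph G \<longleftrightarrow>
     finite (pverts G) \<and> finite (pedges G) \<and>
     (\<forall>e\<in>pedges G. \<exists>g. arc g \<and> path_image g = e \<and>
        e \<inter> pverts G = {pathstart g, pathfinish g}) \<and>
     (\<forall>e\<in>pedges G. \<forall>e'\<in>pedges G. e \<noteq> e' \<longrightarrow> e \<inter> e' \<subseteq> pverts G) \<and>
     inj_on (\<lambda>e. e \<inter> pverts G) (pedges G)"

definition underlying :: "plane_drawing \<Rightarrow> complex ugraph" where
  "underlying G = \<lparr>uverts = pverts G, uedges = (\<lambda>e. e \<inter> pverts G) ` pedges G\<rparr>"

definition faces :: "plane_drawing \<Rightarrow> complex set set" where
  "faces G = components (- (pverts G \<union> \<Union>(pedges G)))"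

text \<open>The closed curve formed by the edges of the triangle with vertex set \<open>S\<close>.\<close>

definition triangle_curve :: "plane_drawing \<Rightarrow> complex set \<Rightarrow> complex set" where
  "triangle_curve G S = \<Union>{e \<in> pedges G. e \<inter> pverts G \<subseteq> S}"

text \<open>The outer face is one of the faces, so it is covered by the second conjunct.\<close>

definition plane_triangulation :: "plane_drawing \<Rightarrow> bool" where
  "plane_triangulation G \<longleftrightarrow> simple_plane_graph G \<and>
     (\<forall>F\<in>faces G. \<exists>S. is_triangle (underlying G) S \<and> frontier F = triangle_curve G S)"


section \<open>Decomposition trees\<close>

definition drawing_within :: "plane_drawing \<Rightarrow> complex set \<Rightarrow> plane_drawing" where
  "drawing_within G A = \<lparr>pverts = pverts G \<inter> A, pedges = {e \<in> pedges G. e \<subseteq> A}\<rparr>"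

definition inner_part :: "plane_drawing \<Rightarrow> complex set \<Rightarrow> plane_drawing" where
  "inner_part G S = drawing_within G (triangle_curve G S \<union> inside (triangle_curve G S))"

definition outer_part :: "plane_drawing \<Rightarrow> complex set \<Rightarrow> plane_drawing" where
  "outer_part G S = drawing_within G (triangle_curve G S \<union> outside (triangle_curve G S))"

text \<open>
  \<open>decomposition G P\<close>: splitting \<open>G\<close> along separating triangles, in some order, until none is
  left yields the set of pieces \<open>P\<close>.
\<close>

inductive decomposition :: "plane_drawing \<Rightarrow> plane_drawing set \<Rightarrow> bool" where
  piece: "(\<nexists>S. separating_triangle (underlying G) S) \<Longrightarrow> decomposition G {G}"
| split: "separating_triangle (underlying G) S \<Longrightarrow>
    decomposition (inner_part G S) P \<Longrightarrow> decomposition (outer_part G S) Q \<Longrightarrow>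
    decomposition G (P \<union> Q)"

definition piece_graph :: "plane_drawing \<Rightarrow> plane_drawing set \<Rightarrow> plane_drawing ugraph" where
  "piece_graph G P = \<lparr>uverts = P, uedges = {{A, B} | A B. A \<in> P \<and> B \<in> P \<and> A \<noteq> B \<and>
     (\<exists>S. separating_triangle (underlying G) S \<and>
          is_triangle (underlying A) S \<and> is_triangle (underlying B) S)}\<rparr>"

definition has_decomposition_tree :: "plane_drawing \<Rightarrow> 'a ugraph \<Rightarrow> bool" where
  "has_decomposition_tree G T \<longleftrightarrow> (\<exists>P. decomposition G P \<and> graph_iso (piece_graph G P) T)"

end

theory Submission
  imports Defs
begin

text \<open>
  Every node of the tree is realized by a double wheel (two poles joined to a common rim cycle
  of length at least 4), which is 3-connected and has no separating triangle. Starting with a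
  node of degree \<open>d \<ge> 4\<close>, realized by a double wheel with rim length exactly \<open>d\<close>, the tree is
  traversed and each new node is realized by a double wheel drawn inside a free face
  \<open>{a, r i, r (i + 1)}\<close> at the pole \<open>a\<close> of its neighbour. The last triangle filled splits the
  graph into the last piece and the triangulation built before, so the decomposition tree is
  the given tree. In the end all \<open>d\<close> faces at the pole \<open>a\<close> of the first wheel are filled. Let
  \<open>X\<close> consist of \<open>a\<close> and its rim. Removing these \<open>d + 1\<close> vertices leaves at least \<open>d + 1\<close>
  components: one in each of the \<open>d\<close> faces, and that of the other pole. A hamiltonian path
  between two vertices of \<open>X\<close> could visit only \<open>d\<close> of them.

  All drawings have straight edges. A double wheel with a prescribed outer triangle arises by
  stellar subdivisions: a vertex in the triangle, a vertex in one of the three new triangles,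
  and then repeatedly a vertex on a rim edge.
\<close>

section \<open>Simplicial families and their stellar subdivisions\<close>

definition bary :: "'a::real_vector set \<Rightarrow> 'a \<Rightarrow> ('a \<Rightarrow> real) \<Rightarrow> bool" where
  "bary f w u \<longleftrightarrow> (\<forall>v. 0 \<le> u v) \<and> (\<forall>v. v \<notin> f \<longrightarrow> u v = 0) \<and> sum u f = 1 \<and>
     (\<Sum>v\<in>f. u v *\<^sub>R v) = w"

text \<open>
  Uniqueness of barycentric coordinates across the whole family says at once that every member
  is affinely independent and that any two convex hulls meet in the hull of the common vertices.
\<close>

definition simplicial :: "'a::real_vector set set \<Rightarrow> bool" where
  "simplicial F \<longleftrightarrow> (\<forall>f\<in>F. finite f) \<and>
     (\<forall>f\<in>F. \<forall>g\<in>F. \<forall>w u u'. bary f w u \<longrightarrow> bary g w u' \<longrightarrow> u = u')"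

lemma bary_convex_hull:
  assumes "finite f"
  shows "w \<in> convex hull f \<longleftrightarrow> (\<exists>u. bary f w u)"
proof
  assume "w \<in> convex hull f"
  then obtain u where u: "\<forall>x\<in>f. 0 \<le> u x" "sum u f = 1" "(\<Sum>x\<in>f. u x *\<^sub>R x) = w"
    using assms by (auto simp: convex_hull_finite)
  define u' where "u' = (\<lambda>v. if v \<in> f then u v else 0)"
  have "sum u' f = 1" "(\<Sum>x\<in>f. u' x *\<^sub>R x) = w"
    using u by (auto simp: u'_def cong: sum.cong)
  then show "\<exists>u. bary f w u"
    using u by (auto simp: bary_def u'_def intro!: exI[of _ u'])
next
  assume "\<exists>u. bary f w u"
  then show "w \<in> convex hull f"
    using assms by (auto simp: bary_def convex_hull_finite)
qed

lemma bary_mono: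
  assumes "bary e w u" "e \<subseteq> f" "finite f"
  shows "bary f w u"
proof -
  have "u v = 0" if "v \<notin> e" for v
    using assms(1) that by (simp add: bary_def)
  then have "sum u f = sum u e" "(\<Sum>v\<in>f. u v *\<^sub>R v) = (\<Sum>v\<in>e. u v *\<^sub>R v)"
    using assms by (auto intro!: sum.mono_neutral_right)
  then show ?thesis
    using assms by (auto simp: bary_def)
qed

lemma bary_restrict:
  assumes "bary f w u" "e \<subseteq> f" "finite f" "\<And>v. v \<notin> e \<Longrightarrow> u v = 0"
  shows "bary e w u"
proof -
  have "sum u f = sum u e" "(\<Sum>v\<in>f. u v *\<^sub>R v) = (\<Sum>v\<in>e. u v *\<^sub>R v)"
    using assms by (auto intro!: sum.mono_neutral_right)
  then show ?thesis
    using assms by (auto simp: bary_def)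
qed

lemma bary_support: "bary f w u \<Longrightarrow> u v \<noteq> 0 \<Longrightarrow> v \<in> f"
  by (auto simp: bary_def)

lemma bary_vertex:
  assumes "v \<in> f" "finite f"
  shows "bary f v (\<lambda>x. if x = v then 1 else 0)"
proof -
  have "(\<Sum>x\<in>f. (if x = v then 1 else 0) *\<^sub>R x) = (\<Sum>x\<in>f. if x = v then v else 0)"
    by (rule sum.cong) auto
  also have "\<dots> = v"
    using assms by simp
  finally show ?thesis
    unfolding bary_def using assms by (intro conjI) simp_all
qed

lemma simplicial_mono: "simplicial F \<Longrightarrow> F' \<subseteq> F \<Longrightarrow> simplicial F'"
  unfolding simplicial_def by (meson subsetD)

lemma simplicialD:
  "simplicial F \<Longrightarrow> f \<in> F \<Longrightarrow> g \<in> F \<Longrightarrow> bary f w u \<Longrightarrow> bary g w u' \<Longrightarrow> u = u'"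
  unfolding simplicial_def by blast

lemma simplicial_finite: "simplicial F \<Longrightarrow> f \<in> F \<Longrightarrow> finite f"
  unfolding simplicial_def by blast

lemma simplicial_hull_Int:
  assumes F: "simplicial F" and "f \<in> F" "g \<in> F" "e \<subseteq> f" "e' \<subseteq> g"
    and "w \<in> convex hull e" "w \<in> convex hull e'"
  shows "w \<in> convex hull (e \<inter> e')"
proof -
  have fin: "finite f" "finite g" "finite e" "finite e'"
    using assms by (meson simplicial_finite finite_subset)+
  obtain u u' where u: "bary e w u" and u': "bary e' w u'"
    using assms(6,7) bary_convex_hull[OF fin(3)] bary_convex_hull[OF fin(4)] by auto
  have "u = u'"
    by (rule simplicialD[OF F assms(2,3)])
      (rule bary_mono[OF u assms(4) fin(1)], rule bary_mono[OF u' assms(5) fin(2)])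
  then have "bary (e \<inter> e') w u"
    using u u' fin by (intro bary_restrict[OF u]) (auto simp: bary_def)
  then show ?thesis
    using fin bary_convex_hull by blast
qed

lemma simplicial_vertex:
  assumes F: "simplicial F" and "f \<in> F" "g \<in> F" "e \<subseteq> f" "v \<in> convex hull e" "v \<in> g"
  shows "v \<in> e"
proof -
  have "v \<in> convex hull (e \<inter> {v})"
    using assms by (intro simplicial_hull_Int[of F f g]) auto
  then show ?thesis
    by (cases "v \<in> e") auto
qed

lemma simplicial_affine_independent:
  fixes F :: "'a::euclidean_space set set"
  assumes F: "simplicial F" and f: "f \<in> F"
  shows "\<not> affine_dependent f"
proof
  assume "affine_dependent f"
  then obtain M N where MN: "M \<inter> N = {}" "M \<union> N = f" "convex hull M \<inter> convex hull N \<noteq> {}"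
    using Radon_partition[of f] simplicial_finite[OF F f] by blast
  then obtain w where "w \<in> convex hull M" "w \<in> convex hull N" by blast
  then have "w \<in> convex hull (M \<inter> N)"
    using MN by (intro simplicial_hull_Int[OF F f f]) auto
  then show False
    using MN by simp
qed

lemma simplicial_of_affine_independent:
  fixes D :: "'a::real_vector set"
  assumes "finite D" "\<not> affine_dependent D" and F: "\<And>f. f \<in> F \<Longrightarrow> f \<subseteq> D"
  shows "simplicial F"
  unfolding simplicial_def
proof (intro conjI ballI allI impI)
  show "finite f" if "f \<in> F" for f
    using that assms finite_subset by blast
next
  fix f g w u u'
  assume fg: "f \<in> F" "g \<in> F" and u: "bary f w u" "bary g w u'"
  have D: "bary D w u" "bary D w u'"
    using fg u assms bary_mono by blast+
  have "sum (\<lambda>v. u v - u' v) D = 0" "(\<Sum>v\<in>D. (u v - u' v) *\<^sub>R v) = 0"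
    using D by (auto simp: bary_def sum_subtractf scaleR_diff_left)
  then have "\<forall>v\<in>D. u v - u' v = 0"
    using assms affine_dependent_explicit_finite[of D] by blast
  then have "u v = u' v" for v
    using D by (cases "v \<in> D") (auto simp: bary_def)
  then show "u = u'" by blast
qed

text \<open>
  The stellar subdivision of the family \<open>F\<close> at a point \<open>z\<close> in the relative interior of the
  simplex \<open>s\<close>.
\<close>

definition stellar :: "'a set \<Rightarrow> 'a \<Rightarrow> 'a set set \<Rightarrow> 'a set set" where
  "stellar s z F = {f \<in> F. \<not> s \<subseteq> f} \<union> {insert z (f - {x}) | f x. f \<in> F \<and> s \<subseteq> f \<and> x \<in> s}"

lemma bary_unsubdivide:
  assumes z: "bary s z l" "z \<notin> f" and sf: "s \<subseteq> f" "x \<in> s" and fin: "finite f"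
    and u: "bary (insert z (f - {x})) w u"
  shows "bary f w (\<lambda>v. (if v = z then 0 else u v) + u z * l v)"
proof -
  have lf: "bary f z l"
    using z sf fin bary_mono by blast
  have xz: "x \<noteq> z" using z sf by auto
  have ux: "u x = 0"
    using u xz by (auto simp: bary_def)
  have s1: "(\<Sum>v\<in>f. if v = z then 0 else u v) = sum u (f - {x})"
    using fin ux z by (intro sum.mono_neutral_cong_right) auto
  have s2: "(\<Sum>v\<in>f. (if v = z then 0 else u v) *\<^sub>R v) = (\<Sum>v\<in>f - {x}. u v *\<^sub>R v)"
    using fin ux z by (intro sum.mono_neutral_cong_right) auto
  have "sum u (f - {x}) + u z = 1" "(\<Sum>v\<in>f - {x}. u v *\<^sub>R v) + u z *\<^sub>R z = w"
    using u z fin by (auto simp: bary_def add.commute)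
  moreover have "(\<Sum>v\<in>f. u z * l v) = u z" "(\<Sum>v\<in>f. (u z * l v) *\<^sub>R v) = u z *\<^sub>R z"
    using lf by (simp_all add: bary_def sum_distrib_left[symmetric] scaleR_sum_right[symmetric]
        scaleR_scaleR[symmetric] del: scaleR_scaleR)
  ultimately show ?thesis
    using u lf z s1 s2 unfolding bary_def by (auto simp: sum.distrib scaleR_add_left)
qed

lemma bary_subdivide:
  assumes z: "bary s z l" "z \<notin> f" and pos: "\<And>v. v \<in> s \<Longrightarrow> 0 < l v"
    and sf: "s \<subseteq> f" and fin: "finite f" and u: "bary f w u"
  obtains x u' where "x \<in> s" "bary (insert z (f - {x})) w u'"
proof -
  have fins: "finite s" using fin sf finite_subset by blast
  have "s \<noteq> {}" using z by (auto simp: bary_def)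
  define t where "t = Min ((\<lambda>v. u v / l v) ` s)"
  have "t \<in> (\<lambda>v. u v / l v) ` s"
    unfolding t_def using fins \<open>s \<noteq> {}\<close> by (intro Min_in) auto
  then obtain x where x: "x \<in> s" "t = u x / l x" by auto
  have tle: "t \<le> u v / l v" if "v \<in> s" for v
    unfolding t_def using that fins by auto
  have nonneg: "0 \<le> u v - t * l v" for v
  proof (cases "v \<in> s")
    case True
    then show ?thesis using tle[OF True] pos[OF True] by (simp add: field_simps)
  next
    case False
    then show ?thesis using z u by (auto simp: bary_def)
  qed
  have t0: "0 \<le> t"
    using x pos[OF x(1)] u by (auto simp: bary_def)
  have x0: "u x - t * l x = 0" using x pos[OF x(1)] by simp
  have lf: "bary f z l"
    using z sf fin bary_mono by blast
  define u' where "u' = (\<lambda>v. if v = z then t else u v - t * l v)"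
  have s1: "sum u' (f - {x}) = (\<Sum>v\<in>f. u v - t * l v)"
    using fin x0 z sf x by (intro sum.mono_neutral_cong_left) (auto simp: u'_def)
  have s2: "(\<Sum>v\<in>f - {x}. u' v *\<^sub>R v) = (\<Sum>v\<in>f. (u v - t * l v) *\<^sub>R v)"
    using fin x0 z sf x by (intro sum.mono_neutral_cong_left) (auto simp: u'_def)
  have "(\<Sum>v\<in>f. u v - t * l v) = 1 - t"
    using u lf by (simp add: bary_def sum_subtractf sum_distrib_left[symmetric])
  moreover have "(\<Sum>v\<in>f. (u v - t * l v) *\<^sub>R v) = w - t *\<^sub>R z"
    using u lf by (simp add: bary_def sum_subtractf scaleR_diff_left scaleR_sum_right[symmetric]
        scaleR_scaleR[symmetric] del: scaleR_scaleR)
  moreover have "u' z = t" by (simp add: u'_def)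
  ultimately have "sum u' (insert z (f - {x})) = 1" "(\<Sum>v\<in>insert z (f - {x}). u' v *\<^sub>R v) = w"
    using s1 s2 z fin by auto
  moreover have "u' v = 0" if "v \<notin> insert z (f - {x})" for v
    using that x0 u lf by (cases "v = x") (auto simp: u'_def bary_def)
  moreover have "0 \<le> u' v" for v
    using t0 nonneg by (auto simp: u'_def)
  ultimately have "bary (insert z (f - {x})) w u'"
    by (auto simp: bary_def)
  with x show ?thesis by (intro that)
qed

text \<open>
  \<open>lift\<close> translates coordinates with respect to the subdivision into the original ones. It is
  injective on coordinates that vanish somewhere on \<open>s\<close>, since two preimages with equal
  lifts differ by a multiple of the positive coordinates \<open>l\<close> of \<open>z\<close>.
\<close>

lemma simplicial_stellar:
  assumes F: "simplicial F" and z: "bary s z l" "z \<notin> \<Union>F" and pos: "\<And>v. v \<in> s \<Longrightarrow> 0 < l v"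
    and s: "s \<subseteq> f0" "f0 \<in> F"
  shows "simplicial (stellar s z F)"
proof -
  define lift where "lift = (\<lambda>u v. (if v = z then 0 else u v) + u z * l v)"
  have zs: "z \<notin> s" using z s by blast
  have lift: "(\<exists>f\<in>F. bary f w (lift u)) \<and> (\<exists>x\<in>s. u x = 0)"
    if f': "f' \<in> stellar s z F" "bary f' w u" for f' w u
  proof (cases "f' \<in> F \<and> \<not> s \<subseteq> f'")
    case True
    then have "u z = 0"
      using that z by (auto simp: bary_def)
    then have "lift u = u" by (auto simp: lift_def)
    then show ?thesis
      using that True by (auto simp: bary_def)
  next
    case False
    then obtain f x where f: "f' = insert z (f - {x})" "f \<in> F" "s \<subseteq> f" "x \<in> s"
      using f'(1) unfolding stellar_def by blast
    have "bary f w (lift u)"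
      unfolding lift_def
      using bary_unsubdivide[OF z(1) _ f(3,4)] that(2) f(1,2) z(2) simplicial_finite[OF F f(2)] by blast
    moreover have "u x = 0"
      using that f zs by (auto simp: bary_def)
    ultimately show ?thesis using f by blast
  qed
  show ?thesis
    unfolding simplicial_def
  proof (intro conjI ballI allI impI)
    fix f assume "f \<in> stellar s z F"
    then show "finite f" using simplicial_finite[OF F] by (auto simp: stellar_def)
  next
    fix f g w u u'
    assume fg: "f \<in> stellar s z F" "g \<in> stellar s z F" and u: "bary f w u" "bary g w u'"
    obtain x y where xy: "x \<in> s" "u x = 0" "y \<in> s" "u' y = 0"
      using lift fg u by meson
    have eq: "lift u = lift u'"
      using lift fg u simplicialD[OF F] by meson
    have "0 \<le> u v" "0 \<le> u' v" for v using u by (auto simp: bary_def)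
    moreover have "lift u x = lift u' x" "lift u y = lift u' y" using eq by auto
    ultimately have "u' z * l x \<le> u z * l x" "u z * l y \<le> u' z * l y"
      using xy zs by (auto simp: lift_def split: if_splits)
       (smt (verit))+
    then have zz: "u z = u' z"
      using pos[OF xy(1)] pos[OF xy(3)] by auto
    have "u v = u' v" for v
      using fun_cong[OF eq, of v] zz by (auto simp: lift_def split: if_splits)
    then show "u = u'" by blast
  qed
qed

lemma hull_stellar:
  assumes fin: "\<And>f. f \<in> F \<Longrightarrow> finite f" and z: "bary s z l" "z \<notin> \<Union>F"
    and pos: "\<And>v. v \<in> s \<Longrightarrow> 0 < l v"
  shows "(\<Union>f\<in>stellar s z F. convex hull f) = (\<Union>f\<in>F. convex hull f)"
proof
  show "(\<Union>f\<in>stellar s z F. convex hull f) \<subseteq> (\<Union>f\<in>F. convex hull f)"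
  proof clarify
    fix w f' assume f': "f' \<in> stellar s z F" "w \<in> convex hull f'"
    show "w \<in> (\<Union>f\<in>F. convex hull f)"
    proof (cases "f' \<in> F")
      case False
      then obtain f x where *: "f' = insert z (f - {x})" "f \<in> F" "s \<subseteq> f" "x \<in> s"
        using f' unfolding stellar_def by blast
      then obtain u where "bary (insert z (f - {x})) w u"
        using f' fin bary_convex_hull[of f' w] by auto
      then have "bary f w (\<lambda>v. (if v = z then 0 else u v) + u z * l v)"
        using z * fin by (intro bary_unsubdivide[of s z l f x]) auto
      then show ?thesis
        using * fin bary_convex_hull[of f w] by blast
    qed (use f' in blast)
  qed
  show "(\<Union>f\<in>F. convex hull f) \<subseteq> (\<Union>f\<in>stellar s z F. convex hull f)"
  proof clarify
    fix w f assume f: "f \<in> F" "w \<in> convex hull f"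
    show "w \<in> (\<Union>f\<in>stellar s z F. convex hull f)"
    proof (cases "s \<subseteq> f")
      case True
      obtain u where "bary f w u" using f fin bary_convex_hull by blast
      then obtain x u' where "x \<in> s" "bary (insert z (f - {x})) w u'"
        using bary_subdivide[of s z l f w u] z pos True fin f by blast
      then have "w \<in> convex hull (insert z (f - {x}))" "insert z (f - {x}) \<in> stellar s z F"
        using fin f True bary_convex_hull[of "insert z (f - {x})" w] by (auto simp: stellar_def)
      then show ?thesis by blast
    qed (use f in \<open>auto simp: stellar_def\<close>)
  qed
qed

section \<open>Triangulated triangles\<close>

definition sides :: "'a set \<Rightarrow> 'a set set" where
  "sides D = {e. e \<subseteq> D \<and> card e = 2}"

text \<open>
  Requiring \<open>sides D\<close> in the simplicial family excludes additional vertices on the boundary of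
  \<open>D\<close>, so that a tiling of a face can replace that face.
\<close>

definition tiling :: "'a::real_vector set \<Rightarrow> 'a set set \<Rightarrow> bool" where
  "tiling D F \<longleftrightarrow> finite F \<and> (\<forall>f\<in>F. card f = 3) \<and> card D = 3 \<and> simplicial (F \<union> sides D) \<and>
     (\<Union>f\<in>F. convex hull f) = convex hull D \<and> (\<forall>e\<in>sides D. \<exists>f\<in>F. e \<subseteq> f)"

lemma card_3_finite: "card f = 3 \<Longrightarrow> finite f"
  by (rule card_ge_0_finite) simp

lemma side_through:
  assumes "card D = 3" "x \<in> D"
  obtains e where "e \<in> sides D" "x \<in> e"
proof -
  have "finite D" using assms card_3_finite by blast
  then have "card (D - {x}) = 2" using assms by simp
  then obtain y where "y \<in> D" "y \<noteq> x" by (metis card_2_iff' Diff_iff singleton_iff)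
  then show ?thesis
    using assms by (intro that[of "{x, y}"]) (auto simp: sides_def)
qed

lemma proper_subset_in_side:
  assumes "card f = 3" "e \<subseteq> f" "e \<noteq> f"
  obtains a where "a \<in> f" "e \<subseteq> f - {a}" "f - {a} \<in> sides f"
proof -
  obtain a where "a \<in> f" "a \<notin> e" using assms by blast
  moreover have "card (f - {a}) = 2" using assms \<open>a \<in> f\<close> by simp
  ultimately show ?thesis
    using assms by (intro that[of a]) (auto simp: sides_def)
qed

lemma sides_eq:
  assumes "card f = 3"
  shows "sides f = {f - {a} | a. a \<in> f}"
proof -
  have fin: "finite f" using assms card_3_finite by blast
  have "\<exists>a\<in>f. e = f - {a}" if "e \<in> sides f" for e
  proof -
    have e: "e \<subseteq> f" "card e = 2" using that by (auto simp: sides_def)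
    then obtain a where a: "a \<in> f" "e \<subseteq> f - {a}" using assms proper_subset_in_side[of f e] by force
    then have "e = f - {a}" using e assms fin by (intro card_subset_eq) auto
    then show ?thesis using a by blast
  qed
  moreover have "f - {a} \<in> sides f" if "a \<in> f" for a
    using that assms fin by (simp add: sides_def)
  ultimately show ?thesis by blast
qed

lemma tiling_vertices:
  assumes "tiling D F"
  shows "D \<subseteq> \<Union>F"
proof
  fix x assume "x \<in> D"
  moreover have "card D = 3" using assms by (simp add: tiling_def)
  ultimately obtain e where "e \<in> sides D" "x \<in> e" by (metis side_through)
  then show "x \<in> \<Union>F" using assms unfolding tiling_def by blast
qed

lemma tiling_hull_subset: "tiling D F \<Longrightarrow> f \<in> F \<Longrightarrow> convex hull f \<subseteq> convex hull D"
  unfolding tiling_def by blast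

lemma tiling_simplicial: "tiling D F \<Longrightarrow> simplicial F"
  unfolding tiling_def using simplicial_mono[of "F \<union> sides D" F] by simp

lemma tiling_trivial:
  fixes D :: "'a::euclidean_space set"
  assumes "card D = 3" "\<not> affine_dependent D"
  shows "tiling D {D}"
proof -
  have "finite D" using assms card_3_finite by blast
  then have "simplicial ({D} \<union> sides D)"
    using assms by (intro simplicial_of_affine_independent[of D]) (auto simp: sides_def)
  then show ?thesis
    using assms by (auto simp: tiling_def sides_def)
qed

lemma tiling_stellar:
  fixes D :: "'a::real_vector set"
  assumes t: "tiling D F" and s: "s \<subseteq> f0" "f0 \<in> F" "2 \<le> card s" "\<And>e. e \<in> sides D \<Longrightarrow> \<not> s \<subseteq> e"
    and z: "bary s z l" and pos: "\<And>v. v \<in> s \<Longrightarrow> 0 < l v"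
  shows "tiling D (stellar s z F)" "z \<notin> \<Union>F"
proof -
  have F: "finite F" "\<And>f. f \<in> F \<Longrightarrow> card f = 3" "card D = 3" "simplicial (F \<union> sides D)"
    "(\<Union>f\<in>F. convex hull f) = convex hull D" "\<And>e. e \<in> sides D \<Longrightarrow> \<exists>f\<in>F. e \<subseteq> f"
    using t by (auto simp: tiling_def)
  have fin: "finite f" if "f \<in> F" for f using F that card_3_finite by blast
  have fins: "finite s" using s fin finite_subset by blast
  show znew: "z \<notin> \<Union>F"
  proof
    assume "z \<in> \<Union>F"
    then obtain g where g: "g \<in> F" "z \<in> g" by blast
    have "l = (\<lambda>x. if x = z then 1 else 0)"
      using simplicialD[OF F(4), of f0 g z] bary_vertex[OF g(2) fin[OF g(1)]] g s
        bary_mono[OF z s(1) fin[OF s(2)]] by blast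
    then have "s \<subseteq> {z}" using pos by (auto split: if_splits) (metis less_irrefl)
    then have "card s \<le> 1" using card_mono[of "{z}" s] by simp
    then show False using s by simp
  qed
  have zD: "z \<notin> \<Union>(F \<union> sides D)"
    using znew F(6) by blast
  have st: "stellar s z (F \<union> sides D) = stellar s z F \<union> sides D"
    using s(4) by (auto simp: stellar_def)
  have "simplicial (stellar s z F \<union> sides D)"
    using simplicial_stellar[OF F(4) z zD pos s(1)] s(2) st by simp
  moreover have "(\<Union>f\<in>stellar s z F. convex hull f) = convex hull D"
    using hull_stellar[OF fin z znew pos] F(5) by simp
  moreover have "finite (stellar s z F)"
  proof -
    have "{insert z (f - {x}) | f x. f \<in> F \<and> s \<subseteq> f \<and> x \<in> s} \<subseteq> (\<lambda>(f, x). insert z (f - {x})) ` (F \<times> s)"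
      by auto
    then show ?thesis
      unfolding stellar_def using F(1) fins finite_subset by fastforce
  qed
  moreover have "card f = 3" if f: "f \<in> stellar s z F" for f
  proof (cases "f \<in> F")
    case False
    then obtain g x where g: "f = insert z (g - {x})" "g \<in> F" "s \<subseteq> g" "x \<in> s"
      using f unfolding stellar_def by blast
    then have "z \<notin> g" "finite g" "card g = 3" "x \<in> g" using znew F(2) fin by auto
    then show ?thesis using g by simp
  qed (use F in auto)
  moreover have "\<exists>f\<in>stellar s z F. e \<subseteq> f" if e: "e \<in> sides D" for e
  proof -
    obtain f where f: "f \<in> F" "e \<subseteq> f" using F(6) e by blast
    show ?thesis
    proof (cases "s \<subseteq> f")
      case True
      obtain x where "x \<in> s" "x \<notin> e" using s(4)[OF e] by blast
      then have "insert z (f - {x}) \<in> stellar s z F" "e \<subseteq> insert z (f - {x})"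
        using f True by (auto simp: stellar_def)
      then show ?thesis by blast
    qed (use f in \<open>auto simp: stellar_def\<close>)
  qed
  ultimately show "tiling D (stellar s z F)"
    using F(3) by (auto simp: tiling_def)
qed

lemma barycenter:
  fixes s :: "'a::real_vector set"
  assumes "finite s" "s \<noteq> {}"
  obtains z l where "bary s z l" "\<And>v. v \<in> s \<Longrightarrow> 0 < l v"
proof -
  define l :: "'a \<Rightarrow> real" where "l = (\<lambda>v. if v \<in> s then 1 / real (card s) else 0)"
  have "sum l s = 1" using assms by (simp add: l_def)
  then have "bary s (\<Sum>v\<in>s. l v *\<^sub>R v) l" by (auto simp: bary_def l_def)
  moreover have "0 < l v" if "v \<in> s" for v
    using that assms by (simp add: l_def card_gt_0_iff)
  ultimately show ?thesis using that by blast
qed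

lemma tiling_fill:
  assumes t: "tiling D F" and f: "f \<in> F" and t': "tiling f F'"
  shows "tiling D (F - {f} \<union> F')" "\<Union>F \<inter> \<Union>F' = f" "\<Union>(F - {f} \<union> F') = \<Union>F \<union> \<Union>F'"
proof -
  have F: "finite F" "\<And>f. f \<in> F \<Longrightarrow> card f = 3" "card D = 3" "simplicial (F \<union> sides D)"
    "(\<Union>f\<in>F. convex hull f) = convex hull D" "\<And>e. e \<in> sides D \<Longrightarrow> \<exists>f\<in>F. e \<subseteq> f"
    using t by (auto simp: tiling_def)
  have F': "finite F'" "\<And>f. f \<in> F' \<Longrightarrow> card f = 3" "card f = 3" "simplicial (F' \<union> sides f)"
    "(\<Union>f\<in>F'. convex hull f) = convex hull f" "\<And>e. e \<in> sides f \<Longrightarrow> \<exists>f\<in>F'. e \<subseteq> f"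
    using t' by (auto simp: tiling_def)
  have fin: "finite g" if "g \<in> F \<union> sides D" for g using that F(4) simplicial_finite by blast
  have fin': "finite g" if "g \<in> F' \<union> sides f" for g using that F'(4) simplicial_finite by blast
  have mixed: "u = u'"
    if g: "g \<in> F - {f} \<union> sides D" and h: "h \<in> F'" and u: "bary g w u" "bary h w u'" for g h w u u'
  proof -
    have "w \<in> convex hull f" using h u F'(5) bary_convex_hull fin' by blast
    then obtain uf where uf: "bary f w uf" using bary_convex_hull fin f by blast
    have ueq: "u = uf" using simplicialD[OF F(4), of g f w u uf] g f u uf by blast
    have "f \<inter> g \<noteq> f"
    proof
      assume "f \<inter> g = f"
      then have "f \<subseteq> g" by blast
      moreover have "finite g" using fin g by blast
      ultimately have "card f \<le> card g" "card g = 3 \<longrightarrow> f = g"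
        using F'(3) card_mono[of g f] card_subset_eq[of g f] by auto
      then show False using g F(2) F'(3) by (auto simp: sides_def)
    qed
    then obtain a where a: "f \<inter> g \<subseteq> f - {a}" "f - {a} \<in> sides f"
      using proper_subset_in_side[of f "f \<inter> g"] F'(3) by blast
    have zero: "uf v = 0" if "v \<notin> f - {a}" for v
    proof (rule ccontr)
      assume "uf v \<noteq> 0"
      then have "v \<in> f \<inter> g" using bary_support[OF uf] bary_support[OF u(1)] ueq by simp
      then show False using a that by blast
    qed
    have "finite f" using fin f by blast
    then have "bary (f - {a}) w uf"
      by (rule bary_restrict[OF uf Diff_subset _ zero])
    then show ?thesis
      using simplicialD[OF F'(4), of "f - {a}" h w uf u'] a(2) h u(2) ueq by simp
  qed
  have "simplicial ((F - {f} \<union> F') \<union> sides D)"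
    unfolding simplicial_def
  proof (intro conjI ballI allI impI)
    show "finite g" if "g \<in> (F - {f} \<union> F') \<union> sides D" for g using that fin fin' by blast
  next
    fix g h w u u'
    assume g: "g \<in> (F - {f} \<union> F') \<union> sides D" and h: "h \<in> (F - {f} \<union> F') \<union> sides D"
      and u: "bary g w u" "bary h w u'"
    consider "g \<in> F - {f} \<union> sides D" "h \<in> F - {f} \<union> sides D" | "g \<in> F - {f} \<union> sides D" "h \<in> F'"
      | "g \<in> F'" "h \<in> F - {f} \<union> sides D" | "g \<in> F'" "h \<in> F'" using g h by blast
    then show "u = u'"
    proof cases
      case 1 then show ?thesis using simplicialD[OF F(4), of g h w u u'] u by blast
    next
      case 2 then show ?thesis using mixed u by blast
    next
      case 3 then show ?thesis using mixed[of h g w u' u] u by blast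
    next
      case 4 then show ?thesis using simplicialD[OF F'(4), of g h w u u'] u by blast
    qed
  qed
  moreover have "(\<Union>g\<in>F - {f} \<union> F'. convex hull g) = convex hull D"
  proof -
    have "(\<Union>g\<in>F - {f} \<union> F'. convex hull g) = (\<Union>g\<in>F - {f}. convex hull g) \<union> convex hull f"
      by (simp only: F'(5)[symmetric] UN_Un)
    also have "\<dots> = (\<Union>g\<in>insert f (F - {f}). convex hull g)" by blast
    finally show ?thesis using F(5) insert_Diff[OF f] by metis
  qed
  moreover have "\<exists>g\<in>F - {f} \<union> F'. e \<subseteq> g" if e: "e \<in> sides D" for e
  proof -
    obtain g where g: "g \<in> F" "e \<subseteq> g" using F(6) e by blast
    then show ?thesis
    proof (cases "g = f")
      case True
      then have "e \<in> sides f" using g e by (auto simp: sides_def)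
      then show ?thesis using F'(6) by blast
    qed blast
  qed
  ultimately show "tiling D (F - {f} \<union> F')"
    using F(1,2,3) F'(1,2) by (auto simp: tiling_def)
  have fV: "f \<subseteq> \<Union>F'" using tiling_vertices[OF t'] .
  have "v \<in> f" if "v \<in> g" "g \<in> F" "v \<in> h" "h \<in> F'" for v g h
  proof -
    have "v \<in> convex hull h" using that(3) by (rule hull_inc)
    then have "v \<in> convex hull f" using that(4) F'(5) by auto
    then show ?thesis using simplicial_vertex[OF F(4), of f g f v] that f by simp
  qed
  then show "\<Union>F \<inter> \<Union>F' = f" using fV f by blast
  show "\<Union>(F - {f} \<union> F') = \<Union>F \<union> \<Union>F'" using fV by blast
qed

section \<open>Straight-line drawings of triangulated triangles\<close>

definition skeleton :: "'a set set \<Rightarrow> 'a ugraph" where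
  "skeleton F = \<lparr>uverts = \<Union>F, uedges = \<Union>(sides ` F)\<rparr>"

definition draw :: "complex set set \<Rightarrow> plane_drawing" where
  "draw F = \<lparr>pverts = \<Union>F, pedges = (\<lambda>e. convex hull e) ` \<Union>(sides ` F)\<rparr>"

lemma skeleton_adj: "adj (skeleton F) x y \<longleftrightarrow> x \<noteq> y \<and> (\<exists>f\<in>F. x \<in> f \<and> y \<in> f)"
  by (auto simp: adj_def skeleton_def sides_def card_2_iff doubleton_eq_iff)

lemma is_triangle_subset: "is_triangle G S \<Longrightarrow> S \<subseteq> uverts G"
  by (auto simp: is_triangle_def vcycle_def)

lemma is_triangle_skeleton:
  "is_triangle (skeleton F) S \<longleftrightarrow> card S = 3 \<and> sides S \<subseteq> \<Union>(sides ` F)"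
proof
  assume "is_triangle (skeleton F) S"
  then obtain a b c where S: "S = {a, b, c}" "vcycle (skeleton F) [a, b, c]"
    by (auto simp: is_triangle_def)
  then have d: "a \<noteq> b" "b \<noteq> c" "a \<noteq> c" by (auto simp: vcycle_def)
  have "{a, b} \<in> uedges (skeleton F)" "{b, c} \<in> uedges (skeleton F)" "{a, c} \<in> uedges (skeleton F)"
    using S by (auto simp: vcycle_def adj_def insert_commute)
  moreover have "S - {a} = {b, c}" "S - {b} = {a, c}" "S - {c} = {a, b}" using S(1) d by auto
  ultimately have Sx: "S - {x} \<in> \<Union>(sides ` F)" if "x \<in> {a, b, c}" for x
    using that by (elim insertE emptyE) (simp_all only: skeleton_def ugraph.simps)
  have S3: "card S = 3" using S(1) d by simp
  have "e \<in> \<Union>(sides ` F)" if e: "e \<in> sides S" for e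
  proof -
    obtain x where "x \<in> S" "e = S - {x}" using e sides_eq[OF S3] by blast
    then show ?thesis using Sx[of x] S(1) by simp
  qed
  then show "card S = 3 \<and> sides S \<subseteq> \<Union>(sides ` F)" using S3 by blast
next
  assume S: "card S = 3 \<and> sides S \<subseteq> \<Union>(sides ` F)"
  then obtain a b c where abc: "S = {a, b, c}" "a \<noteq> b" "b \<noteq> c" "a \<noteq> c"
    by (auto simp: card_3_iff)
  then have "{a, b} \<in> sides S" "{b, c} \<in> sides S" "{c, a} \<in> sides S"
    by (auto simp: sides_def)
  then have e: "{a, b} \<in> \<Union>(sides ` F)" "{b, c} \<in> \<Union>(sides ` F)" "{c, a} \<in> \<Union>(sides ` F)"
    using S by auto
  then have "{a, b, c} \<subseteq> \<Union>F" by (auto simp: sides_def)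
  then have "vcycle (skeleton F) [a, b, c]"
    using e abc by (auto simp: vcycle_def adj_def skeleton_def)
  then show "is_triangle (skeleton F) S" using abc by (auto simp: is_triangle_def)
qed

lemma frontier_triangle:
  fixes S :: "complex set"
  assumes "card S = 3"
  shows "frontier (convex hull S) = (\<Union>e\<in>sides S. convex hull e)"
  using frontier_of_convex_hull[of S] assms by (auto simp: sides_eq[OF assms])

lemma edge_hull_vertices:
  assumes "simplicial F" "e \<in> \<Union>(sides ` F)"
  shows "convex hull e \<inter> \<Union>F = e"
proof
  obtain f where f: "f \<in> F" "e \<subseteq> f" using assms by (auto simp: sides_def)
  show "convex hull e \<inter> \<Union>F \<subseteq> e"
    using simplicial_vertex[OF assms(1) f(1) _ f(2)] by blast
  show "e \<subseteq> convex hull e \<inter> \<Union>F" using f hull_subset[of e convex] by blast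
qed

lemma underlying_draw:
  assumes "simplicial F"
  shows "underlying (draw F) = skeleton F"
  using edge_hull_vertices[OF assms] by (simp add: underlying_def draw_def skeleton_def image_image)

lemma simple_plane_graph_draw:
  assumes F: "simplicial F" "finite F"
  shows "simple_plane_graph (draw F)"
  unfolding simple_plane_graph_def
proof (intro conjI ballI impI)
  show "finite (pverts (draw F))"
    using F simplicial_finite by (auto simp: draw_def)
  have "finite (sides f)" if "f \<in> F" for f
    using simplicial_finite[OF F(1) that] by (auto simp: sides_def intro: finite_subset[of _ "Pow f"])
  then show "finite (pedges (draw F))" using F by (simp add: draw_def)
next
  fix h assume "h \<in> pedges (draw F)"
  then obtain e where e: "e \<in> \<Union>(sides ` F)" "h = convex hull e" by (auto simp: draw_def)
  then obtain x y where xy: "e = {x, y}" "x \<noteq> y" by (auto simp: sides_def card_2_iff)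
  have "path_image (linepath x y) = h" using e xy by (simp add: segment_convex_hull)
  moreover have "h \<inter> pverts (draw F) = {x, y}"
    using edge_hull_vertices[OF F(1) e(1)] e(2) xy by (simp add: draw_def)
  ultimately show "\<exists>g. arc g \<and> path_image g = h \<and> h \<inter> pverts (draw F) = {pathstart g, pathfinish g}"
    using xy by (intro exI[of _ "linepath x y"]) (auto simp: arc_linepath)
next
  fix h h' assume h: "h \<in> pedges (draw F)" "h' \<in> pedges (draw F)" "h \<noteq> h'"
  then obtain e e' where e: "e \<in> \<Union>(sides ` F)" "h = convex hull e"
    "e' \<in> \<Union>(sides ` F)" "h' = convex hull e'" by (auto simp: draw_def)
  then have "e \<noteq> e'" using h by auto
  obtain f f' where f: "f \<in> F" "e \<subseteq> f" "f' \<in> F" "e' \<subseteq> f'" using e by (auto simp: sides_def)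
  have c: "card e = 2" "card e' = 2" using e by (auto simp: sides_def)
  have "e \<inter> e' \<noteq> e"
    using \<open>e \<noteq> e'\<close> c card_subset_eq[of e' e] card_ge_0_finite[of e'] by auto
  then have "card (e \<inter> e') < 2"
    using c psubset_card_mono[of e "e \<inter> e'"] card_ge_0_finite[of e] by auto
  moreover have "finite (e \<inter> e')" using c card_ge_0_finite[of e] by simp
  ultimately consider "e \<inter> e' = {}" | x where "e \<inter> e' = {x}"
    by (metis card_0_eq card_1_singletonE less_2_cases One_nat_def)
  moreover have "h \<inter> h' \<subseteq> convex hull (e \<inter> e')"
    using simplicial_hull_Int[OF F(1) f(1,3,2,4)] e by blast
  ultimately have "h \<inter> h' \<subseteq> e" by cases auto
  then show "h \<inter> h' \<subseteq> pverts (draw F)" using f by (auto simp: draw_def)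
next
  show "inj_on (\<lambda>e. e \<inter> pverts (draw F)) (pedges (draw F))"
    using edge_hull_vertices[OF F(1)] by (auto simp: inj_on_def draw_def)
qed

lemma triangle_curve_draw:
  assumes F: "simplicial F" and S: "is_triangle (skeleton F) S"
  shows "triangle_curve (draw F) S = frontier (convex hull S)"
proof -
  have S': "card S = 3" "sides S \<subseteq> \<Union>(sides ` F)" using S by (auto simp: is_triangle_skeleton)
  have "{h \<in> pedges (draw F). h \<inter> pverts (draw F) \<subseteq> S} = (\<lambda>e. convex hull e) ` sides S"
  proof (intro subset_antisym subsetI)
    fix h assume "h \<in> {h \<in> pedges (draw F). h \<inter> pverts (draw F) \<subseteq> S}"
    then obtain e where e: "e \<in> \<Union>(sides ` F)" "h = convex hull e" "convex hull e \<inter> \<Union>F \<subseteq> S"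
      by (auto simp: draw_def)
    then have "e \<subseteq> S" using edge_hull_vertices[OF F e(1)] by simp
    moreover have "card e = 2" using e(1) by (auto simp: sides_def)
    ultimately show "h \<in> (\<lambda>e. convex hull e) ` sides S" using e by (auto simp: sides_def)
  next
    fix h assume "h \<in> (\<lambda>e. convex hull e) ` sides S"
    then obtain e where e: "e \<in> sides S" "h = convex hull e" by blast
    then have "convex hull e \<inter> \<Union>F = e" using edge_hull_vertices[OF F] S' by blast
    then show "h \<in> {h \<in> pedges (draw F). h \<inter> pverts (draw F) \<subseteq> S}"
      using e S' by (auto simp: draw_def sides_def)
  qed
  then show ?thesis
    unfolding triangle_curve_def using frontier_triangle[OF S'(1)] by simp
qed

lemma tiling_interior_disjoint:
  fixes F :: "complex set set"
  assumes t: "tiling D F" and f: "f \<in> F" and g: "g \<in> F \<union> sides D" "g \<noteq> f"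
  shows "interior (convex hull f) \<inter> convex hull g = {}"
proof (rule ccontr)
  assume "interior (convex hull f) \<inter> convex hull g \<noteq> {}"
  then obtain w where w: "w \<in> interior (convex hull f)" "w \<in> convex hull g" by blast
  have F: "\<And>f. f \<in> F \<Longrightarrow> card f = 3" "simplicial (F \<union> sides D)"
    using t by (auto simp: tiling_def)
  have "w \<in> convex hull (f \<inter> g)"
    using w f g interior_subset by (intro simplicial_hull_Int[OF F(2), of f g]) auto
  have "finite g" using simplicial_finite F(2) g(1) by blast
  have "f \<inter> g \<noteq> f"
  proof
    assume "f \<inter> g = f"
    then have "f \<subseteq> g" by blast
    then have "card f \<le> card g" "card g = 3 \<longrightarrow> f = g"
      using F(1)[OF f] card_mono[of g f] card_subset_eq[of g f] \<open>finite g\<close> by auto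
    then show False using g F(1) f by (auto simp: sides_def)
  qed
  then obtain a where a: "a \<in> f" "f \<inter> g \<subseteq> f - {a}" "f - {a} \<in> sides f"
    using proper_subset_in_side[of f "f \<inter> g"] F(1) f by blast
  have "w \<in> convex hull (f - {a})" using \<open>w \<in> convex hull (f \<inter> g)\<close> hull_mono[OF a(2)] by blast
  then have "w \<in> frontier (convex hull f)" using frontier_triangle[OF F(1)[OF f]] a by blast
  then show False using w by (auto simp: frontier_def)
qed

lemma tiling_outer_triangle: "tiling D F \<Longrightarrow> is_triangle (skeleton F) D"
  by (auto simp: is_triangle_skeleton tiling_def sides_def)

lemma tiling_face_triangle: "tiling D F \<Longrightarrow> f \<in> F \<Longrightarrow> is_triangle (skeleton F) f"
  by (auto simp: is_triangle_skeleton tiling_def)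

lemma closed_hull_triangle:
  fixes f :: "complex set"
  shows "card f = 3 \<Longrightarrow> closed (convex hull f)" "card f = 3 \<Longrightarrow> bounded (convex hull f)"
  by (simp_all add: card_3_finite finite_imp_compact_convex_hull compact_imp_closed finite_imp_bounded
      bounded_convex_hull)

lemma faces_draw:
  assumes t: "tiling D F"
  shows "faces (draw F) = insert (- (convex hull D)) ((\<lambda>f. interior (convex hull f)) ` F)"
  unfolding faces_def
proof (rule components_open_unique)
  have F: "finite F" "\<And>f. f \<in> F \<Longrightarrow> card f = 3" "card D = 3" "simplicial (F \<union> sides D)"
    "(\<Union>f\<in>F. convex hull f) = convex hull D" "\<And>e. e \<in> sides D \<Longrightarrow> \<exists>f\<in>F. e \<subseteq> f"
    using t by (auto simp: tiling_def)
  let ?A = "insert (- (convex hull D)) ((\<lambda>f. interior (convex hull f)) ` F)"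
  have int_sub: "interior (convex hull f) \<subseteq> convex hull D" if "f \<in> F" for f
    using tiling_hull_subset[OF t that] interior_subset by blast
  have disj: "disjnt (interior (convex hull f)) (interior (convex hull g))"
    if "f \<in> F" "g \<in> F" "f \<noteq> g" for f g
    using tiling_interior_disjoint[OF t that(1), of g] that interior_subset by (fastforce simp: disjnt_def)
  show "pairwise disjnt ?A"
  proof (rule pairwiseI)
    fix X Y assume "X \<in> ?A" "Y \<in> ?A" "X \<noteq> Y"
    then show "disjnt X Y"
      using disj int_sub by (fastforce simp: disjnt_def)
  qed
  have UV: "pverts (draw F) \<union> \<Union>(pedges (draw F)) = (\<Union>f\<in>F. frontier (convex hull f))"
  proof -
    have "\<Union>(pedges (draw F)) = (\<Union>f\<in>F. frontier (convex hull f))"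
      using F(2) by (auto simp: draw_def frontier_triangle)
    moreover have "v \<in> frontier (convex hull f)" if v: "v \<in> f" "f \<in> F" for v f
    proof -
      obtain e where "e \<in> sides f" "v \<in> e" using side_through[OF F(2)[OF v(2)] v(1)] by blast
      then show ?thesis using frontier_triangle[OF F(2)[OF v(2)]] hull_inc[of v e convex] by blast
    qed
    ultimately show ?thesis by (auto simp: draw_def)
  qed
  have hull_split: "convex hull f = interior (convex hull f) \<union> frontier (convex hull f)" if "f \<in> F" for f
    using closed_hull_triangle(1)[OF F(2)[OF that]] interior_subset[of "convex hull f"]
    by (auto simp: frontier_def)
  have int_fr: "interior (convex hull f) \<inter> frontier (convex hull g) = {}" if "f \<in> F" "g \<in> F" for f g
  proof (cases "g = f")
    case False
    then show ?thesis
      using tiling_interior_disjoint[OF t that(1), of g] that hull_split[OF that(2)] by blast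
  qed (auto simp: frontier_def)
  have "convex hull D = (\<Union>f\<in>F. interior (convex hull f)) \<union> (\<Union>f\<in>F. frontier (convex hull f))"
    using F(5) hull_split by blast
  moreover have "(\<Union>f\<in>F. interior (convex hull f)) \<inter> (\<Union>f\<in>F. frontier (convex hull f)) = {}"
    using int_fr by blast
  ultimately show "\<Union>?A = - (pverts (draw F) \<union> \<Union>(pedges (draw F)))"
    unfolding UV Union_insert by blast
  show "open X \<and> connected X \<and> X \<noteq> {}" if X: "X \<in> ?A" for X
  proof (cases "X = - (convex hull D)")
    case True
    have "open X" using True closed_hull_triangle(1)[OF F(3)] by auto
    moreover have "connected X" unfolding True
      using closed_hull_triangle(2)[OF F(3)] by (intro connected_complement_bounded_convex) auto
    moreover have "X \<noteq> {}"
      using True closed_hull_triangle(2)[OF F(3)] not_bounded_UNIV[where 'a=complex]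
      by (metis Compl_empty_eq double_compl)
    ultimately show ?thesis by blast
  next
    case False
    then obtain f where f: "f \<in> F" "X = interior (convex hull f)" using X by blast
    have "\<not> affine_dependent f" using simplicial_affine_independent[OF F(4)] f by blast
    then have "X \<noteq> {}" using f F(2) interior_convex_hull_eq_empty[of f] by simp
    moreover have "connected X" using f by (simp add: convex_connected convex_interior)
    ultimately show ?thesis using f by simp
  qed
qed

lemma plane_triangulation_draw:
  assumes t: "tiling D F"
  shows "plane_triangulation (draw F)"
  unfolding plane_triangulation_def
proof (intro conjI ballI)
  have F: "finite F" "simplicial F" using t tiling_simplicial[OF t] by (auto simp: tiling_def)
  then show "simple_plane_graph (draw F)" by (intro simple_plane_graph_draw)
  fix X assume "X \<in> faces (draw F)"
  then consider "X = - (convex hull D)" | f where "f \<in> F" "X = interior (convex hull f)"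
    by (auto simp: faces_draw[OF t])
  then show "\<exists>S. is_triangle (underlying (draw F)) S \<and> frontier X = triangle_curve (draw F) S"
  proof cases
    case 1
    then show ?thesis
      using tiling_outer_triangle[OF t] triangle_curve_draw[OF F(2)] underlying_draw[OF F(2)] by auto
  next
    case 2
    have f3: "card f = 3" using t 2 by (auto simp: tiling_def)
    have "\<not> affine_dependent f" using simplicial_affine_independent[OF F(2)] 2 by blast
    then have "interior (convex hull f) \<noteq> {}" using f3 interior_convex_hull_eq_empty[of f] by simp
    then have "frontier (interior (convex hull f)) = frontier (convex hull f)"
      using convex_closure_interior[OF convex_convex_hull[of f]] by (simp add: frontier_def)
    then show ?thesis
      using 2 tiling_face_triangle[OF t 2(1)] triangle_curve_draw[OF F(2)] underlying_draw[OF F(2)] by auto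
  qed
qed

lemma parts_of_fill:
  assumes t: "tiling D F" and f: "f \<in> F" and t': "tiling f F'"
  shows "inner_part (draw (F - {f} \<union> F')) f = draw F'"
    and "outer_part (draw (F - {f} \<union> F')) f = draw F"
proof -
  let ?G = "F - {f} \<union> F'"
  note fill = tiling_fill[OF t f t']
  have F: "\<And>f. f \<in> F \<Longrightarrow> card f = 3" "simplicial F"
    using t tiling_simplicial[OF t] by (auto simp: tiling_def)
  have F': "\<And>f. f \<in> F' \<Longrightarrow> card f = 3" "simplicial (F' \<union> sides f)"
    using t' by (auto simp: tiling_def)
  have sG: "simplicial ?G" using tiling_simplicial[OF fill(1)] .
  have fsides: "sides f \<subseteq> \<Union>(sides ` F')" using t' by (auto simp: tiling_def sides_def)
  have f3: "card f = 3" using F f by blast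
  have edges: "\<Union>(sides ` ?G) = \<Union>(sides ` F) \<union> \<Union>(sides ` F')" using fsides by auto
  have curve: "triangle_curve (draw ?G) f = frontier (convex hull f)"
    using f3 fsides by (intro triangle_curve_draw sG) (auto simp: is_triangle_skeleton)
  have inside: "inside (frontier (convex hull f)) = interior (convex hull f)"
    using closed_hull_triangle(2)[OF f3] by (intro inside_frontier_eq_interior) auto
  have split: "convex hull f = frontier (convex hull f) \<union> interior (convex hull f)"
    using closed_hull_triangle(1)[OF f3] interior_subset[of "convex hull f"]
    by (auto simp: frontier_def)
  have in_hull: "v \<in> f" if "v \<in> \<Union>F" "v \<in> convex hull f" for v
    using that simplicial_vertex[OF F(2) f _ subset_refl] by blast
  have on_frontier: "v \<in> f" if v: "v \<in> \<Union>F'" "v \<notin> interior (convex hull f)" for v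
  proof -
    obtain h where h: "h \<in> F'" "v \<in> h" using v by blast
    have "v \<in> convex hull f"
      using tiling_hull_subset[OF t' h(1)] hull_inc[OF h(2), of convex] by blast
    then have "v \<in> frontier (convex hull f)" using v split by blast
    then obtain e where e: "e \<in> sides f" "v \<in> convex hull e" using frontier_triangle[OF f3] by blast
    then have "v \<in> e" using simplicial_vertex[OF F'(2), of e h e v] h by simp
    then show ?thesis using e by (auto simp: sides_def)
  qed
  have F'hull: "\<Union>F' \<subseteq> convex hull f"
    using tiling_hull_subset[OF t'] hull_subset by fastforce
  have Fout: "convex hull g \<inter> interior (convex hull f) = {}" if "g \<in> F" "g \<noteq> f" for g
    using tiling_interior_disjoint[OF t f, of g] that by blast
  have eout: "convex hull e \<inter> interior (convex hull f) = {}" if e: "e \<in> \<Union>(sides ` F)" for e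
  proof -
    obtain g where g: "g \<in> F" "e \<in> sides g" using e by blast
    show ?thesis
    proof (cases "g = f")
      case True
      then have "convex hull e \<subseteq> frontier (convex hull f)" using frontier_triangle[OF f3] g by blast
      then show ?thesis by (auto simp: frontier_def)
    next
      case False
      then show ?thesis using Fout g hull_mono[of e g convex] by (auto simp: sides_def)
    qed
  qed
  have vout: "v \<notin> interior (convex hull f)" if v: "v \<in> \<Union>F" for v
  proof -
    obtain g where g: "g \<in> F" "v \<in> g" using v by blast
    obtain e where "e \<in> sides g" "v \<in> e" using side_through[OF F(1)[OF g(1)] g(2)] by blast
    then show ?thesis using eout[of e] g hull_inc[of v e convex] by blast
  qed
  have esub: "e \<subseteq> convex hull e" for e :: "complex set" by (rule hull_subset)
  show "inner_part (draw ?G) f = draw F'"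
  proof -
    have "\<Union>?G \<inter> convex hull f = \<Union>F'"
      using fill(3) in_hull F'hull tiling_vertices[OF t'] by blast
    moreover have "{h \<in> (\<lambda>e. convex hull e) ` \<Union>(sides ` ?G). h \<subseteq> convex hull f}
        = (\<lambda>e. convex hull e) ` \<Union>(sides ` F')" (is "?L = ?R")
    proof (intro subset_antisym subsetI)
      fix h assume "h \<in> ?L"
      then obtain e where e: "e \<in> \<Union>(sides ` ?G)" "h = convex hull e" "convex hull e \<subseteq> convex hull f"
        by blast
      show "h \<in> ?R"
      proof (cases "e \<in> \<Union>(sides ` F')")
        case False
        then have eF: "e \<in> \<Union>(sides ` F)" using e edges by blast
        then have "e \<subseteq> \<Union>F" "card e = 2" by (auto simp: sides_def)
        moreover have "e \<subseteq> convex hull f" using e(3) esub[of e] by blast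
        ultimately have "e \<in> sides f" using in_hull by (auto simp: sides_def)
        then show ?thesis using fsides e by blast
      qed (use e in blast)
    next
      fix h assume "h \<in> ?R"
      then obtain e g where e: "g \<in> F'" "e \<in> sides g" "h = convex hull e" by blast
      have "convex hull e \<subseteq> convex hull f"
        using tiling_hull_subset[OF t' e(1)] hull_mono[of e g convex] e(2) by (auto simp: sides_def)
      then show "h \<in> ?L" using e by blast
    qed
    ultimately show ?thesis
      unfolding inner_part_def curve inside split[symmetric] drawing_within_def by (simp add: draw_def)
  qed
  show "outer_part (draw ?G) f = draw F"
  proof -
    have "\<Union>?G \<inter> - interior (convex hull f) = \<Union>F"
      using fill(3) on_frontier vout f by blast
    moreover have "{h \<in> (\<lambda>e. convex hull e) ` \<Union>(sides ` ?G). h \<subseteq> - interior (convex hull f)}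
        = (\<lambda>e. convex hull e) ` \<Union>(sides ` F)" (is "?L = ?R")
    proof (intro subset_antisym subsetI)
      fix h assume "h \<in> ?L"
      then obtain e where e: "e \<in> \<Union>(sides ` ?G)" "h = convex hull e"
        "convex hull e \<subseteq> - interior (convex hull f)" by blast
      show "h \<in> ?R"
      proof (cases "e \<in> \<Union>(sides ` F)")
        case False
        then have "e \<in> \<Union>(sides ` F')" using e edges by blast
        then have "e \<subseteq> \<Union>F'" "card e = 2" by (auto simp: sides_def)
        moreover have "e \<subseteq> - interior (convex hull f)" using e(3) esub[of e] by blast
        ultimately have "e \<in> sides f" using on_frontier by (auto simp: sides_def)
        then show ?thesis using f e by blast
      qed (use e in blast)
    next
      fix h assume "h \<in> ?R"
      then obtain e where e: "e \<in> \<Union>(sides ` F)" "h = convex hull e" by blast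
      then show "h \<in> ?L" using eout[OF e(1)] edges by blast
    qed
    ultimately show ?thesis
      unfolding outer_part_def curve union_with_outside inside drawing_within_def by (simp add: draw_def)
  qed
qed

section \<open>Double wheels\<close>

definition fan :: "'a \<Rightarrow> (nat \<Rightarrow> 'a) \<Rightarrow> nat \<Rightarrow> 'a set set" where
  "fan c r n = (\<lambda>i. {c, r i, r (Suc i)}) ` {..<n}"

definition slots :: "'a \<Rightarrow> (nat \<Rightarrow> 'a) \<Rightarrow> nat \<Rightarrow> 'a set set" where
  "slots a r n = insert {a, r n, r 0} (fan a r n)"

text \<open>
  The bounded faces of a double wheel with poles \<open>a\<close> and \<open>b\<close> and rim \<open>r 0, \<dots>, r n\<close>; its
  outer face is \<open>{b, r 0, r n}\<close>.
\<close>

definition wheel :: "'a \<Rightarrow> 'a \<Rightarrow> (nat \<Rightarrow> 'a) \<Rightarrow> nat \<Rightarrow> 'a set set" where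
  "wheel a b r n = slots a r n \<union> fan b r n"

definition wheel_tiling :: "'a::real_vector set \<Rightarrow> 'a \<Rightarrow> 'a \<Rightarrow> (nat \<Rightarrow> 'a) \<Rightarrow> nat \<Rightarrow> bool" where
  "wheel_tiling D a b r n \<longleftrightarrow> tiling D (wheel a b r n) \<and> D = {b, r 0, r n} \<and> inj_on r {..n} \<and>
     a \<notin> r ` {..n} \<and> b \<notin> r ` {..n} \<and> a \<noteq> b"

lemma stellar_Un: "stellar s z (F \<union> F') = stellar s z F \<union> stellar s z F'"
  unfolding stellar_def by auto

lemma stellar_id: "(\<And>f. f \<in> F \<Longrightarrow> \<not> s \<subseteq> f) \<Longrightarrow> stellar s z F = F"
  unfolding stellar_def by blast

lemma stellar_single:
  "s \<subseteq> f \<Longrightarrow> stellar s z {f} = (\<lambda>x. insert z (f - {x})) ` s"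
  unfolding stellar_def by blast

lemma stellar_edge:
  assumes "x \<noteq> y" "c \<noteq> x" "c \<noteq> y"
  shows "stellar {x, y} z {{c, x, y}} = {{c, x, z}, {c, z, y}}"
proof -
  have "{c, x, y} - {x} = {c, y}" "{c, x, y} - {y} = {c, x}" using assms by auto
  then show ?thesis by (auto simp: stellar_single)
qed

lemma stellar_triangle:
  assumes "p \<noteq> q" "p \<noteq> c" "q \<noteq> c"
  shows "stellar {p, q, c} z {{p, q, c}} = {{z, q, c}, {z, p, c}, {z, p, q}}"
proof -
  have "{p, q, c} - {p} = {q, c}" "{p, q, c} - {q} = {p, c}" "{p, q, c} - {c} = {p, q}"
    using assms by auto
  then show ?thesis by (auto simp: stellar_single)
qed

lemma wheel_tiling_base:
  fixes D :: "'a::euclidean_space set"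
  assumes D: "card D = 3" "\<not> affine_dependent D"
  shows "\<exists>a b r. wheel_tiling D a b r 2"
proof -
  obtain b q p where bqp: "D = {b, q, p}" "b \<noteq> q" "q \<noteq> p" "b \<noteq> p"
    using D(1) by (auto simp: card_3_iff)
  have t0: "tiling D {D}" using D by (rule tiling_trivial)
  have nos: "\<not> s \<subseteq> e" if "card s = 3" "e \<in> sides D" for s e
  proof
    assume "s \<subseteq> e"
    moreover have "finite e" using that by (auto simp: sides_def intro: card_ge_0_finite)
    ultimately show False using that card_mono[of e s] by (auto simp: sides_def)
  qed
  obtain c l where c: "bary D c l" "\<And>v. v \<in> D \<Longrightarrow> 0 < l v"
    by (rule barycenter[of D]) (use bqp in auto)
  have t1: "tiling D (stellar D c {D})" and cD: "c \<notin> D"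
    using tiling_stellar[OF t0 subset_refl _ _ _ c] D(1) nos by auto
  have cb: "c \<noteq> b" "c \<noteq> q" "c \<noteq> p" using cD bqp by auto
  define F1 where "F1 = {{c, q, p}, {c, b, p}, {c, b, q}}"
  have F1: "stellar D c {D} = F1"
    using stellar_triangle[of b q p c] bqp by (simp add: F1_def)
  define s where "s = {q, p, c}"
  have s3: "card s = 3" using bqp cb by (auto simp: s_def)
  obtain a m where a: "bary s a m" "\<And>v. v \<in> s \<Longrightarrow> 0 < m v"
    by (rule barycenter[of s]) (auto simp: s_def)
  have sF1: "s \<in> F1" by (auto simp: s_def F1_def)
  have t2: "tiling D (stellar s a F1)" and aF: "a \<notin> \<Union>F1"
    using tiling_stellar[OF t1[unfolded F1] subset_refl sF1 _ _ a] s3 nos[OF s3] by auto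
  have ab: "a \<noteq> b" "a \<noteq> q" "a \<noteq> p" "a \<noteq> c" using aF by (auto simp: F1_def)
  have "F1 = {s} \<union> {{c, b, p}, {c, b, q}}" by (auto simp: F1_def s_def)
  moreover have "stellar s a {{c, b, p}, {c, b, q}} = {{c, b, p}, {c, b, q}}"
    using bqp cb by (intro stellar_id) (auto simp: s_def)
  moreover have "stellar s a {s} = {{a, p, c}, {a, q, c}, {a, q, p}}"
    unfolding s_def using bqp cb by (intro stellar_triangle) auto
  ultimately have F2: "stellar s a F1 = {{a, p, c}, {a, q, c}, {a, q, p}} \<union> {{c, b, p}, {c, b, q}}"
    by (simp only: stellar_Un)
  define r where "r = (\<lambda>i::nat. if i = 0 then q else if i = 1 then c else p)"
  have r: "r 0 = q" "r (Suc 0) = c" "r 2 = p" "r (Suc (Suc 0)) = p" by (auto simp: r_def)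
  have l2: "{..<2::nat} = {0, Suc 0}" "{..2::nat} = {0, Suc 0, 2}" by auto
  have "wheel a b r 2 = {{a, p, q}, {a, q, c}, {a, c, p}, {b, q, c}, {b, c, p}}"
    by (simp add: wheel_def slots_def fan_def l2 r insert_commute)
  also have "\<dots> = stellar s a F1" unfolding F2 by (simp add: insert_commute)
  finally have "tiling D (wheel a b r 2)" using t2 by simp
  moreover have "inj_on r {..2}" using bqp cb by (auto simp: l2 r inj_on_def)
  moreover have "a \<notin> r ` {..2}" "b \<notin> r ` {..2}" using ab bqp cb by (auto simp: l2 r)
  ultimately have "wheel_tiling D a b r 2"
    unfolding wheel_tiling_def using bqp ab by (simp add: r)
  then show ?thesis by blast
qed

lemma wheel_verts: "1 \<le> n \<Longrightarrow> \<Union>(wheel a b r n) = {a, b} \<union> r ` {..n}"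
proof -
  assume n: "1 \<le> n"
  have "r i \<in> \<Union>(wheel a b r n)" if "i \<le> n" for i
  proof (cases "i = n")
    case False
    then have "i < n" using that by simp
    then show ?thesis by (auto simp: wheel_def fan_def)
  qed (auto simp: wheel_def slots_def)
  moreover have "a \<in> \<Union>(wheel a b r n)" by (auto simp: wheel_def slots_def)
  moreover have "b \<in> \<Union>(wheel a b r n)" using n by (auto simp: wheel_def fan_def lessThan_empty_iff)
  moreover have "\<Union>(wheel a b r n) \<subseteq> {a, b} \<union> r ` {..n}"
    by (auto simp: wheel_def slots_def fan_def)
  ultimately show ?thesis by blast
qed

text \<open>The new rim vertex is inserted by a stellar subdivision of the last edge of the path \<open>r\<close>.\<close>

lemma wheel_tiling_step:
  assumes w: "wheel_tiling D a b r n" and n: "2 \<le> n"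
  shows "\<exists>r'. wheel_tiling D a b r' (Suc n)"
proof -
  obtain j where j: "n = Suc j" "1 \<le> j" using n by (cases n) auto
  have t: "tiling D (wheel a b r n)" and D: "D = {b, r 0, r n}" and inj: "inj_on r {..n}"
    and ab: "a \<notin> r ` {..n}" "b \<notin> r ` {..n}" "a \<noteq> b"
    using w by (auto simp: wheel_tiling_def)
  have rne: "r i \<noteq> r k" if "i \<le> n" "k \<le> n" "i \<noteq> k" for i k
    using inj that by (auto simp: inj_on_def)
  have abr: "a \<noteq> r i" "b \<noteq> r i" if "i \<le> n" for i using ab that by auto
  define s where "s = {r j, r n}"
  have s2: "card s = 2" using rne[of j n] j by (simp add: s_def)
  obtain z l where z: "bary s z l" "\<And>v. v \<in> s \<Longrightarrow> 0 < l v"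
    by (rule barycenter[of s]) (auto simp: s_def)
  have "r j \<notin> D" using D abr[of j] rne[of j 0] rne[of j n] j by auto
  then have nos: "\<not> s \<subseteq> e" if "e \<in> sides D" for e using that by (auto simp: s_def sides_def)
  have sf: "s \<subseteq> {a, r j, r n}" "{a, r j, r n} \<in> wheel a b r n"
    using j by (auto simp: s_def wheel_def slots_def fan_def)
  note st = tiling_stellar[OF t sf _ nos z, unfolded s2, OF order_refl]
  have zr: "z \<noteq> a" "z \<noteq> b" "z \<notin> r ` {..n}"
    using st(2) wheel_verts[of n a b r] j by auto
  define r' where "r' = r(n := z, Suc n := r n)"
  have r': "r' i = r i" if "i \<le> j" for i using that j by (simp add: r'_def)
  have r'n: "r' n = z" "r' (Suc n) = r n" by (auto simp: r'_def)
  have fan_Suc: "fan c r n = {{c, r j, r n}} \<union> fan c r j" for c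
    by (simp add: fan_def j lessThan_Suc)
  have fan_old: "stellar s z (fan c r j) = fan c r j" if "c \<noteq> r n" for c
  proof (rule stellar_id)
    fix f assume "f \<in> fan c r j"
    then obtain i where "i < j" "f = {c, r i, r (Suc i)}" by (auto simp: fan_def)
    then show "\<not> s \<subseteq> f" using that rne[of n i] rne[of n "Suc i"] j by (auto simp: s_def)
  qed
  have fan_new: "fan c r' (Suc n) = stellar s z (fan c r n)" if "c \<noteq> r n" "c \<noteq> r j" for c
  proof -
    have "fan c r' (Suc n) = {{c, r' n, r' (Suc n)}, {c, r' j, r' n}} \<union> fan c r' j"
      by (simp add: fan_def j lessThan_Suc)
    also have "fan c r' j = fan c r j" unfolding fan_def by (rule image_cong) (auto simp: r')
    finally have "fan c r' (Suc n) = {{c, z, r n}, {c, r j, z}} \<union> fan c r j"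
      by (simp add: r'n r')
    moreover have "stellar s z {{c, r j, r n}} = {{c, r j, z}, {c, z, r n}}"
      unfolding s_def using that rne[of j n] j by (intro stellar_edge) auto
    ultimately show ?thesis
      unfolding fan_Suc stellar_Un fan_old[OF that(1)] by auto
  qed
  have last: "stellar s z {{a, r n, r 0}} = {{a, r n, r 0}}"
    using abr[of j] rne[of j n] rne[of j 0] j by (intro stellar_id) (auto simp: s_def)
  have wl: "wheel a b r n = {{a, r n, r 0}} \<union> fan a r n \<union> fan b r n" for r n
    by (auto simp: wheel_def slots_def)
  have "wheel a b r' (Suc n) = stellar s z (wheel a b r n)"
    unfolding wl stellar_Un last using fan_new[of a] fan_new[of b] abr j r'[of 0] r'n by simp
  then have "tiling D (wheel a b r' (Suc n))" using st(1) by simp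
  moreover have img: "r' ` {..Suc n} = insert z (r ` {..n})"
  proof -
    have "r' ` {..Suc n} = {r n, z} \<union> r' ` {..j}" by (simp add: j atMost_Suc r'n[unfolded j])
    also have "r' ` {..j} = r ` {..j}" by (rule image_cong) (auto simp: r')
    finally show ?thesis by (auto simp: j atMost_Suc)
  qed
  moreover have "inj_on r' {..Suc n}"
  proof (rule eq_card_imp_inj_on)
    show "card (r' ` {..Suc n}) = card {..Suc n}"
      using img zr(3) card_image[OF inj] by simp
  qed simp
  ultimately have "wheel_tiling D a b r' (Suc n)"
    unfolding wheel_tiling_def using D r'[of 0] r'n ab zr by (simp add: img)
  then show ?thesis by blast
qed

lemma wheel_tiling_exists:
  fixes D :: "'a::euclidean_space set"
  assumes D: "card D = 3" "\<not> affine_dependent D" and n: "2 \<le> n"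
  shows "\<exists>a b r. wheel_tiling D a b r n"
  using n
proof (induction n rule: dec_induct)
  case base
  then show ?case using wheel_tiling_base[OF D] .
next
  case (step n)
  then show ?case using wheel_tiling_step by blast
qed

section \<open>Connectivity\<close>

lemma adj_commute: "adj G x y \<longleftrightarrow> adj G y x"
  by (simp add: adj_def insert_commute)

lemma vpath_imp_reachable:
  assumes "vpath G u p v"
  shows "(adj G)\<^sup>*\<^sup>* u v"
proof -
  have "(adj G)\<^sup>*\<^sup>* (hd p) (last p)" if "p \<noteq> []" "successively (adj G) p" for p
    using that
  proof (induction p rule: induct_list012)
    case (3 x y zs)
    then show ?case by (auto intro: converse_rtranclp_into_rtranclp)
  qed auto
  then show ?thesis using assms by (auto simp: vpath_def)
qed

lemma reachable_imp_vpath: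
  assumes "(adj G)\<^sup>*\<^sup>* u v" "u \<in> uverts G" and E: "\<forall>e\<in>uedges G. e \<subseteq> uverts G"
  shows "\<exists>p. vpath G u p v"
  using assms(1)
proof (induction rule: rtranclp_induct)
  case base
  have "vpath G u [u] u" using assms by (simp add: vpath_def)
  then show ?case by blast
next
  case (step y z)
  then obtain p where p: "vpath G u p y" by blast
  have z: "z \<in> uverts G" using E step(2) by (auto simp: adj_def)
  show ?case
  proof (cases "z \<in> set p")
    case True
    then obtain xs ys where xs: "p = xs @ z # ys" by (meson split_list)
    have "hd (xs @ [z]) = u" using p xs by (cases xs) (auto simp: vpath_def)
    then have "vpath G u (xs @ [z]) z"
      using p xs by (auto simp: vpath_def successively_append_iff)
    then show ?thesis by blast
  next
    case False
    then have "vpath G u (p @ [z]) z"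
      using p z step(2) by (auto simp: vpath_def successively_append_iff)
    then show ?thesis by blast
  qed
qed

lemma graph_connected_iff:
  assumes "\<forall>e\<in>uedges G. e \<subseteq> uverts G"
  shows "graph_connected G \<longleftrightarrow> (\<forall>u\<in>uverts G. \<forall>v\<in>uverts G. (adj G)\<^sup>*\<^sup>* u v)"
  using assms reachable_imp_vpath[of G] vpath_imp_reachable[of G]
  unfolding graph_connected_def by meson

lemma reachable_sym: "(adj G)\<^sup>*\<^sup>* u v \<Longrightarrow> (adj G)\<^sup>*\<^sup>* v u"
  by (metis adj_commute sympI symp_rtranclp sympD)

lemma graph_connected_hub:
  assumes "\<forall>e\<in>uedges G. e \<subseteq> uverts G" and "\<And>v. v \<in> uverts G \<Longrightarrow> (adj G)\<^sup>*\<^sup>* h v"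
  shows "graph_connected G"
  unfolding graph_connected_iff[OF assms(1)]
  using assms(2) reachable_sym by (meson rtranclp_trans)

lemma uverts_skeleton [simp]: "uverts (skeleton F) = \<Union>F"
  by (simp add: skeleton_def)

lemma del_skeleton_edges: "\<forall>e\<in>uedges (del_verts (skeleton F) X). e \<subseteq> uverts (del_verts (skeleton F) X)"
  by (auto simp: del_verts_def skeleton_def sides_def)

lemma uverts_del_verts [simp]: "uverts (del_verts G X) = uverts G - X"
  by (simp add: del_verts_def)

lemma adj_del_verts [simp]: "adj (del_verts G X) x y \<longleftrightarrow> adj G x y \<and> x \<notin> X \<and> y \<notin> X"
  by (auto simp: del_verts_def adj_def)

definition component_labelling :: "'a ugraph \<Rightarrow> 'a set \<Rightarrow> ('a \<Rightarrow> 'b) \<Rightarrow> bool" where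
  "component_labelling G X c \<longleftrightarrow> (\<forall>x y. adj G x y \<longrightarrow> x \<notin> X \<longrightarrow> y \<notin> X \<longrightarrow> c x = c y)"

lemma component_labelling_imp_disconnected:
  assumes c: "component_labelling G X c" and uv: "u \<in> uverts G - X" "v \<in> uverts G - X" "c u \<noteq> c v"
  shows "\<not> graph_connected (del_verts G X)"
proof
  assume "graph_connected (del_verts G X)"
  then obtain p where "vpath (del_verts G X) u p v" using uv by (auto simp: graph_connected_def)
  then have "(adj (del_verts G X))\<^sup>*\<^sup>* u v" by (rule vpath_imp_reachable)
  then have "c u = c v"
    by (induction rule: rtranclp_induct) (use c in \<open>auto simp: component_labelling_def\<close>)
  then show False using uv by blast
qed

lemma disconnected_imp_component_labelling:
  assumes "\<not> graph_connected (del_verts (skeleton F) X)"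
  obtains c :: "'a \<Rightarrow> bool" and u v where "component_labelling (skeleton F) X c"
    "u \<in> \<Union>F - X" "v \<in> \<Union>F - X" "c u \<noteq> c v"
proof -
  let ?G = "del_verts (skeleton F) X"
  obtain u v where uv: "u \<in> \<Union>F - X" "v \<in> \<Union>F - X" "\<not> (adj ?G)\<^sup>*\<^sup>* u v"
    using assms unfolding graph_connected_iff[OF del_skeleton_edges] by auto
  define c where "c = (\<lambda>x. (adj ?G)\<^sup>*\<^sup>* u x)"
  have "c x \<Longrightarrow> c y" if "adj (skeleton F) x y" "x \<notin> X" "y \<notin> X" for x y
    unfolding c_def using that by (auto intro: rtranclp.rtrancl_into_rtrancl)
  then have "component_labelling (skeleton F) X c"
    unfolding component_labelling_def using adj_commute by metis
  moreover have "c u" "\<not> c v" using uv by (auto simp: c_def)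
  ultimately show ?thesis using that uv by blast
qed

lemma adj_fill:
  assumes t: "tiling D F" and f: "f \<in> F" and t': "tiling f F'"
  shows "adj (skeleton (F - {f} \<union> F')) x y \<longleftrightarrow> adj (skeleton F) x y \<or> adj (skeleton F') x y"
proof -
  have "adj (skeleton F') x y" if "x \<noteq> y" "x \<in> f" "y \<in> f"
  proof -
    have "{x, y} \<in> sides f" using that by (auto simp: sides_def)
    then obtain g where "g \<in> F'" "{x, y} \<subseteq> g" using t' unfolding tiling_def by blast
    then show ?thesis using that by (auto simp: skeleton_adj)
  qed
  then show ?thesis using f by (fastforce simp: skeleton_adj)
qed

lemma component_labelling_fill:
  fixes c :: "'a::real_vector \<Rightarrow> 'b"
  assumes t: "tiling D F" and f: "f \<in> F" and t': "tiling f F'"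
    and c: "component_labelling (skeleton F) X c"
  shows "\<exists>c'. component_labelling (skeleton (F - {f} \<union> F')) X c' \<and> (\<forall>x\<in>\<Union>F. c' x = c x) \<and>
    (f \<subseteq> X \<longrightarrow> (\<forall>x\<in>\<Union>F' - \<Union>F. c' x = d))"
proof -
  note fill = tiling_fill[OF t f t']
  define e where "e = (if f \<subseteq> X then d else c (SOME v. v \<in> f - X))"
  define c' where "c' = (\<lambda>x. if x \<in> \<Union>F then c x else e)"
  have ce: "c x = e" if x: "x \<in> f - X" for x
  proof -
    have v: "(SOME v. v \<in> f - X) \<in> f - X" using x by (rule someI)
    then have "c x = c (SOME v. v \<in> f - X)"
      using c x f by (cases "x = (SOME v. v \<in> f - X)") (auto simp: component_labelling_def skeleton_adj)
    moreover have "\<not> f \<subseteq> X" using x by blast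
    ultimately show ?thesis by (simp add: e_def)
  qed
  have new: "c' x = e" if "x \<in> \<Union>F'" "x \<notin> X" for x
    using that ce fill(2) unfolding c'_def by (metis IntI DiffI)
  have "component_labelling (skeleton (F - {f} \<union> F')) X c'"
    unfolding component_labelling_def adj_fill[OF t f t']
  proof (intro allI impI, elim disjE)
    fix x y assume "x \<notin> X" "y \<notin> X" "adj (skeleton F) x y"
    moreover from this have "x \<in> \<Union>F" "y \<in> \<Union>F" by (auto simp: skeleton_adj)
    ultimately show "c' x = c' y" using c by (simp add: component_labelling_def c'_def)
  next
    fix x y assume "x \<notin> X" "y \<notin> X" "adj (skeleton F') x y"
    moreover from this have "x \<in> \<Union>F'" "y \<in> \<Union>F'" by (auto simp: skeleton_adj)
    ultimately show "c' x = c' y" using new by simp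
  qed
  moreover have "\<forall>x\<in>\<Union>F. c' x = c x" "f \<subseteq> X \<longrightarrow> (\<forall>x\<in>\<Union>F' - \<Union>F. c' x = d)"
    by (auto simp: c'_def e_def)
  ultimately show ?thesis by blast
qed

lemma separating_fill_mono:
  assumes t: "tiling D F" and f: "f \<in> F" and t': "tiling f F'"
    and S: "separating_triangle (skeleton F) S"
  shows "separating_triangle (skeleton (F - {f} \<union> F')) S"
proof -
  have "is_triangle (skeleton (F - {f} \<union> F')) S"
  proof -
    have "vcycle (skeleton (F - {f} \<union> F')) [x, y, z]" if "vcycle (skeleton F) [x, y, z]" for x y z
      using that adj_fill[OF t f t'] tiling_fill(3)[OF t f t'] by (auto simp: vcycle_def)
    then show ?thesis using S unfolding separating_triangle_def is_triangle_def by metis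
  qed
  moreover obtain c :: "'a \<Rightarrow> bool" and u v where c: "component_labelling (skeleton F) S c"
    "u \<in> \<Union>F - S" "v \<in> \<Union>F - S" "c u \<noteq> c v"
    using S disconnected_imp_component_labelling unfolding separating_triangle_def by blast
  obtain c' where c': "component_labelling (skeleton (F - {f} \<union> F')) S c'" "\<forall>x\<in>\<Union>F. c' x = c x"
    using component_labelling_fill[OF t f t' c(1)] by metis
  have "\<not> graph_connected (del_verts (skeleton (F - {f} \<union> F')) S)"
    using c c' tiling_fill(3)[OF t f t']
    by (intro component_labelling_imp_disconnected[OF c'(1), of u v]) auto
  ultimately show ?thesis by (simp add: separating_triangle_def)
qed

lemma separating_fill_new:
  assumes t: "tiling D F" and f: "f \<in> F" and t': "tiling f F'"
    and u: "u \<in> \<Union>F - f" and v: "v \<in> \<Union>F' - f"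
  shows "separating_triangle (skeleton (F - {f} \<union> F')) f"
proof -
  note fill = tiling_fill[OF t f t']
  have "is_triangle (skeleton (F - {f} \<union> F')) f"
    using t' f t by (auto simp: is_triangle_skeleton tiling_def sides_def)
  moreover have "component_labelling (skeleton (F - {f} \<union> F')) f (\<lambda>x. x \<in> \<Union>F)"
    unfolding component_labelling_def adj_fill[OF t f t'] skeleton_adj using fill(2) by blast
  then have "\<not> graph_connected (del_verts (skeleton (F - {f} \<union> F')) f)"
    using u v fill(2,3) by (intro component_labelling_imp_disconnected[of _ _ _ u v]) auto
  ultimately show ?thesis by (simp add: separating_triangle_def)
qed

lemma rtranclp_adj_mono:
  assumes "(adj G)\<^sup>*\<^sup>* x y" "\<And>x y. adj G x y \<Longrightarrow> adj H x y"
  shows "(adj H)\<^sup>*\<^sup>* x y"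
  using assms(1) by (induction rule: rtranclp_induct) (auto intro: assms(2) rtranclp.rtrancl_into_rtrancl)

lemma k_connected_fill:
  assumes t: "tiling D F" and f: "f \<in> F" and t': "tiling f F'"
    and k: "k_connected 3 (skeleton F)" "k_connected 3 (skeleton F')"
  shows "k_connected 3 (skeleton (F - {f} \<union> F'))"
  unfolding k_connected_def
proof (intro conjI allI impI)
  let ?G = "F - {f} \<union> F'"
  note fill = tiling_fill[OF t f t']
  have fin: "finite (\<Union>F)" "finite (\<Union>F')"
    using k by (auto simp: k_connected_def intro: card_ge_0_finite)
  then have "card (\<Union>F) \<le> card (\<Union>?G)"
    using fill(3) by (intro card_mono) auto
  then show "3 < card (uverts (skeleton ?G))"
    using k(1) unfolding k_connected_def by simp
  fix X assume X: "X \<subseteq> uverts (skeleton ?G)" "card X < 3"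
  have "finite X" using X fin fill(3) finite_subset[of X "\<Union>F \<union> \<Union>F'"] by simp
  have "card f = 3" using t f by (simp add: tiling_def)
  then have "\<not> f \<subseteq> X" using card_mono[OF \<open>finite X\<close>, of f] X(2) by auto
  then obtain h where h: "h \<in> f" "h \<notin> X" by blast
  have hV: "h \<in> \<Union>F" "h \<in> \<Union>F'" using h fill(2) by blast+
  have part: "(adj (del_verts (skeleton ?G) X))\<^sup>*\<^sup>* h v"
    if K: "k_connected 3 (skeleton K)" "h \<in> \<Union>K" "v \<in> \<Union>K - X"
      "\<And>x y. adj (skeleton K) x y \<Longrightarrow> adj (skeleton ?G) x y" for K v
  proof -
    have "card (X \<inter> \<Union>K) < 3" using card_mono[of X "X \<inter> \<Union>K"] \<open>finite X\<close> X(2) by simp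
    then have con: "graph_connected (del_verts (skeleton K) (X \<inter> \<Union>K))"
      using K(1) unfolding k_connected_def by simp
    have "(adj (del_verts (skeleton K) (X \<inter> \<Union>K)))\<^sup>*\<^sup>* h v"
      using con h K(2,3) unfolding graph_connected_iff[OF del_skeleton_edges] by simp
    then show ?thesis
      by (rule rtranclp_adj_mono) (use K(4) in \<open>auto simp: skeleton_adj\<close>)
  qed
  show "graph_connected (del_verts (skeleton ?G) X)"
  proof (rule graph_connected_hub[where h = h, OF del_skeleton_edges])
    fix v assume "v \<in> uverts (del_verts (skeleton ?G) X)"
    then consider "v \<in> \<Union>F - X" | "v \<in> \<Union>F' - X" using fill(3) by auto
    then show "(adj (del_verts (skeleton ?G) X))\<^sup>*\<^sup>* h v"
      by cases (use part k hV adj_fill[OF t f t'] in blast)+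
  qed
qed

lemma too_many_components:
  assumes c: "component_labelling G X c" and p: "vpath G u p v" "set p = uverts G"
    and u: "u \<in> X" "v \<in> X" and X: "X \<subseteq> uverts G"
  shows "card (c ` (uverts G - X)) < card X"
proof -
  have main: "card (c ` (set q - X)) + (if last q \<in> X then 1 else 0) \<le> card (set q \<inter> X)"
    if "q \<noteq> []" "hd q \<in> X" "distinct q" "successively (adj G) q" for q
    using that
  proof (induction q rule: rev_nonempty_induct)
    case (single x)
    then show ?case by simp
  next
    case (snoc x q)
    have q: "card (c ` (set q - X)) + (if last q \<in> X then 1 else 0) \<le> card (set q \<inter> X)"
      using snoc by (auto simp: successively_append_iff)
    have adjx: "adj G (last q) x" using snoc by (auto simp: successively_append_iff)
    show ?case
    proof (cases "x \<in> X")
      case True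
      have "set (q @ [x]) - X = set q - X" "set (q @ [x]) \<inter> X = insert x (set q \<inter> X)"
        using True by auto
      moreover have "x \<notin> set q \<inter> X" using snoc by auto
      ultimately have "card (set (q @ [x]) \<inter> X) = Suc (card (set q \<inter> X))" by simp
      then show ?thesis using q True \<open>set (q @ [x]) - X = set q - X\<close> by (auto split: if_splits)
    next
      case False
      have eq: "set (q @ [x]) - X = insert x (set q - X)" "set (q @ [x]) \<inter> X = set q \<inter> X"
        using False by auto
      show ?thesis
      proof (cases "last q \<in> X")
        case True
        then show ?thesis using q False unfolding eq by (simp add: card_insert_if split: if_splits)
      next
        case l: False
        then have "c x \<in> c ` (set q - X)"
          using c adjx False \<open>q \<noteq> []\<close> unfolding component_labelling_def
          by (metis DiffI image_eqI last_in_set)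
        then show ?thesis using q False l unfolding eq by (simp add: insert_absorb)
      qed
    qed
  qed
  have "uverts G \<inter> X = X" using X by blast
  then show ?thesis
    using main[of p] p u by (auto simp: vpath_def)
qed

section \<open>Connectivity of double wheels\<close>

lemma wheel_adj_rim:
  assumes w: "wheel_tiling D a b r n" and i: "i < n"
  shows "adj (skeleton (wheel a b r n)) (r i) (r (Suc i))"
proof -
  have "r i \<noteq> r (Suc i)"
    using w i inj_onD[of r "{..n}" i "Suc i"] by (auto simp: wheel_tiling_def)
  then show ?thesis using i by (auto simp: skeleton_adj wheel_def fan_def)
qed

lemma wheel_adj_pole:
  assumes w: "wheel_tiling D a b r n" and n: "1 \<le> n" and i: "i \<le> n" and c: "c \<in> {a, b}"
  shows "adj (skeleton (wheel a b r n)) c (r i)"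
proof -
  have "\<exists>f\<in>fan c r n. c \<in> f \<and> r i \<in> f"
  proof (cases "i = n")
    case True
    then have "{c, r (n - 1), r (Suc (n - 1))} \<in> fan c r n" "Suc (n - 1) = n"
      using n unfolding fan_def by auto
    then show ?thesis using True by (metis insertCI)
  qed (use i in \<open>auto simp: fan_def\<close>)
  moreover have "fan c r n \<subseteq> wheel a b r n" using c by (auto simp: wheel_def slots_def)
  moreover have "c \<noteq> r i" using w c i by (auto simp: wheel_tiling_def)
  ultimately show ?thesis by (auto simp: skeleton_adj)
qed

lemma wheel_poles_not_adj:
  assumes w: "wheel_tiling D a b r n"
  shows "\<not> adj (skeleton (wheel a b r n)) a b"
  using w by (auto simp: wheel_tiling_def skeleton_adj wheel_def slots_def fan_def)

lemma wheel_connected_via_pole: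
  assumes w: "wheel_tiling D a b r n" and n: "1 \<le> n" and c: "c \<in> {a, b}" "c \<notin> X"
    and i: "i \<le> n" "r i \<notin> X"
  shows "graph_connected (del_verts (skeleton (wheel a b r n)) X)"
proof (rule graph_connected_hub[where h = c, OF del_skeleton_edges])
  let ?G = "del_verts (skeleton (wheel a b r n)) X"
  have rim: "(adj ?G) c' (r j)" if "c' \<in> {a, b}" "c' \<notin> X" "j \<le> n" "r j \<notin> X" for c' j
    using wheel_adj_pole[OF w n that(3,1)] that by simp
  fix v assume "v \<in> uverts ?G"
  then consider "v \<in> {a, b}" "v \<notin> X" | j where "v = r j" "j \<le> n" "r j \<notin> X"
    using wheel_verts[OF n, of a b r] by auto
  then show "(adj ?G)\<^sup>*\<^sup>* c v"
  proof cases
    case 1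
    have "(adj ?G)\<^sup>*\<^sup>* c (r i)" using rim[OF c i] by blast
    moreover have "adj ?G (r i) v" using rim[OF 1 i] adj_commute by metis
    ultimately show ?thesis by (rule rtranclp.rtrancl_into_rtrancl)
  next
    case 2
    then show ?thesis using rim[OF c] by blast
  qed
qed

lemma rim_escape:
  assumes "inj_on r {..n}" "finite X" "card X \<le> n"
  obtains i where "i \<le> n" "r i \<notin> X"
proof -
  have "card (r ` {..n}) = Suc n" using assms(1) by (simp add: card_image)
  then have "\<not> r ` {..n} \<subseteq> X" using card_mono[OF assms(2), of "r ` {..n}"] assms(3) by auto
  then show ?thesis using that by blast
qed

lemma wheel_k_connected:
  assumes w: "wheel_tiling D a b r n" and n: "2 \<le> n"
  shows "k_connected 3 (skeleton (wheel a b r n))"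
  unfolding k_connected_def
proof (intro conjI allI impI)
  let ?W = "wheel a b r n"
  have inj: "inj_on r {..n}" and ab: "a \<notin> r ` {..n}" "b \<notin> r ` {..n}" "a \<noteq> b"
    using w by (auto simp: wheel_tiling_def)
  have V: "\<Union>?W = {a, b} \<union> r ` {..n}" using n by (intro wheel_verts) simp
  have "card (\<Union>?W) = n + 3" unfolding V using ab inj by (simp add: card_image)
  then show "3 < card (uverts (skeleton ?W))" using n by simp
  fix X assume X: "X \<subseteq> uverts (skeleton ?W)" "card X < 3"
  have fin: "finite X" using X V finite_subset[of X "\<Union>?W"] by simp
  obtain i where i: "i \<le> n" "r i \<notin> X" by (rule rim_escape[OF inj fin]) (use X n in auto)
  show "graph_connected (del_verts (skeleton ?W) X)"
  proof (cases "a \<in> X \<and> b \<in> X")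
    case True
    have "{a, b} = X"
      using True X(2) ab fin by (intro card_seteq) auto
    then have rX: "r j \<notin> X" if "j \<le> n" for j using ab that by auto
    have reach: "(adj (del_verts (skeleton ?W) X))\<^sup>*\<^sup>* (r 0) (r j)" if "j \<le> n" for j
      using that
    proof (induction j)
      case (Suc j)
      then have "adj (del_verts (skeleton ?W) X) (r j) (r (Suc j))"
        using wheel_adj_rim[OF w, of j] rX[of j] rX[of "Suc j"] by simp
      then show ?case using Suc by (auto intro: rtranclp.rtrancl_into_rtrancl)
    qed simp
    show ?thesis
    proof (rule graph_connected_hub[where h = "r 0", OF del_skeleton_edges])
      fix v assume "v \<in> uverts (del_verts (skeleton ?W) X)"
      then obtain j where "j \<le> n" "v = r j" using V True by auto
      then show "(adj (del_verts (skeleton ?W) X))\<^sup>*\<^sup>* (r 0) v" using reach by simp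
    qed
  next
    case False
    then obtain c where "c \<in> {a, b}" "c \<notin> X" by blast
    then show ?thesis using wheel_connected_via_pole[OF w _ _ _ i] n by auto
  qed
qed

lemma wheel_no_separating_triangle:
  assumes w: "wheel_tiling D a b r n" and n: "3 \<le> n"
  shows "\<not> separating_triangle (skeleton (wheel a b r n)) S"
proof
  let ?W = "wheel a b r n"
  assume S: "separating_triangle (skeleton ?W) S"
  then have S3: "card S = 3" "sides S \<subseteq> \<Union>(sides ` ?W)"
    by (auto simp: separating_triangle_def is_triangle_skeleton)
  have ab: "a \<noteq> b" and inj: "inj_on r {..n}" using w by (auto simp: wheel_tiling_def)
  have "\<not> {a, b} \<subseteq> S"
  proof
    assume "{a, b} \<subseteq> S"
    then have "{a, b} \<in> sides S" using ab by (auto simp: sides_def)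
    then have "adj (skeleton ?W) a b" using S3 by (auto simp: adj_def skeleton_def)
    then show False using wheel_poles_not_adj[OF w] by blast
  qed
  then obtain c where c: "c \<in> {a, b}" "c \<notin> S" by blast
  obtain i where i: "i \<le> n" "r i \<notin> S"
    by (rule rim_escape[OF inj card_3_finite[OF S3(1)]]) (use S3 n in auto)
  have "graph_connected (del_verts (skeleton ?W) S)"
    using wheel_connected_via_pole[OF w _ c i] n by simp
  then show False using S by (simp add: separating_triangle_def)
qed

lemma slots_subset_wheel: "slots a r n \<subseteq> wheel a b r n"
  by (auto simp: wheel_def)

lemma slot_pole: "f \<in> slots a r n \<Longrightarrow> a \<in> f"
  by (auto simp: slots_def fan_def)

lemma slot_subset: "f \<in> slots a r n \<Longrightarrow> f \<subseteq> insert a (r ` {..n})"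
  by (auto simp: slots_def fan_def)

lemma card_slots:
  assumes w: "wheel_tiling D a b r n" and n: "2 \<le> n"
  shows "card (slots a r n) = Suc n"
proof -
  have inj: "inj_on r {..n}" and a: "a \<notin> r ` {..n}" using w by (auto simp: wheel_tiling_def)
  have req: "r i = r j \<longleftrightarrow> i = j" if "i \<le> n" "j \<le> n" for i j
    using inj that by (auto simp: inj_on_def)
  have ar: "a \<noteq> r i" if "i \<le> n" for i using a that by auto
  have mem: "r k \<in> {a, r i, r j} \<longleftrightarrow> k = i \<or> k = j" if "i \<le> n" "j \<le> n" "k \<le> n" for i j k
    using req[of k i] req[of k j] ar[of k] that by auto
  have "inj_on (\<lambda>i. {a, r i, r (Suc i)}) {..<n}"
  proof (rule inj_onI)
    fix i j assume ij: "i \<in> {..<n}" "j \<in> {..<n}" "{a, r i, r (Suc i)} = {a, r j, r (Suc j)}"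
    have "i = j \<or> i = Suc j" "Suc i = j \<or> Suc i = Suc j"
      using mem[of j "Suc j" i] mem[of j "Suc j" "Suc i"] ij by auto
    then show "i = j" by auto
  qed
  then have "card (fan a r n) = n" by (simp add: fan_def card_image)
  moreover have "{a, r n, r 0} \<notin> fan a r n"
  proof
    assume "{a, r n, r 0} \<in> fan a r n"
    then obtain i where i: "i < n" "{a, r n, r 0} = {a, r i, r (Suc i)}" by (auto simp: fan_def)
    have "n = i \<or> n = Suc i" "0 = i \<or> 0 = Suc i"
      using mem[of i "Suc i" n] mem[of i "Suc i" 0] i by auto
    then show False using i n by auto
  qed
  ultimately show ?thesis by (simp add: slots_def fan_def)
qed

section \<open>Growing the triangulation along the tree\<close>

text \<open>
  \<open>U\<close> is the part of the tree that is already realized, \<open>\<pi> t\<close> the set of bounded faces of the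
  piece of node \<open>t\<close>, and \<open>\<Phi> t\<close> a set of faces reserved for those neighbours of \<open>t\<close> that are
  still missing. Every missing neighbour of the root \<open>v0\<close> increases the number of components of
  the graph without \<open>X\<close> by one when it is added.
\<close>

locale realization =
  fixes T :: "'a ugraph" and v0 :: 'a and U :: "'a set" and D :: "complex set"
    and F :: "complex set set" and \<pi> \<Phi> :: "'a \<Rightarrow> complex set set" and X :: "complex set"
    and c :: "complex \<Rightarrow> nat"
  assumes finT: "finite (uverts T)"
    and rootU: "v0 \<in> U"
    and tile: "tiling D F"
    and con3: "k_connected 3 (skeleton F)"
    and decomp: "decomposition (draw F) ((\<lambda>t. draw (\<pi> t)) ` U)"
    and pieces_inj: "inj_on (\<lambda>t. \<Union>(\<pi> t)) U"
    and pieces_simplicial: "t \<in> U \<Longrightarrow> simplicial (\<pi> t)"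
    and pieces_subset: "t \<in> U \<Longrightarrow> \<Union>(\<pi> t) \<subseteq> \<Union>F"
    and pieces_adj: "s \<in> U \<Longrightarrow> t \<in> U \<Longrightarrow> s \<noteq> t \<Longrightarrow> adj T s t \<Longrightarrow>
      \<exists>S. separating_triangle (skeleton F) S \<and> is_triangle (skeleton (\<pi> s)) S \<and> is_triangle (skeleton (\<pi> t)) S"
    and pieces_not_adj: "s \<in> U \<Longrightarrow> t \<in> U \<Longrightarrow> s \<noteq> t \<Longrightarrow> card S = 3 \<Longrightarrow> S \<subseteq> \<Union>(\<pi> s) \<Longrightarrow> S \<subseteq> \<Union>(\<pi> t) \<Longrightarrow>
      adj T s t"
    and slots_faces: "s \<in> U \<Longrightarrow> \<Phi> s \<subseteq> F"
    and slots_triangle: "s \<in> U \<Longrightarrow> f \<in> \<Phi> s \<Longrightarrow> is_triangle (skeleton (\<pi> s)) f"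
    and slots_private: "s \<in> U \<Longrightarrow> t \<in> U \<Longrightarrow> s \<noteq> t \<Longrightarrow> f \<in> \<Phi> s \<Longrightarrow> \<not> f \<subseteq> \<Union>(\<pi> t)"
    and slots_card: "s \<in> U \<Longrightarrow> card {t \<in> uverts T - U. adj T s t} \<le> card (\<Phi> s)"
    and X_subset: "X \<subseteq> \<Union>F"
    and labels: "component_labelling (skeleton F) X c"
    and labels_card: "card X \<le> card (c ` (\<Union>F - X)) + card {t \<in> uverts T - U. adj T v0 t}"
    and slots_root: "f \<in> \<Phi> v0 \<Longrightarrow> f \<subseteq> X"
begin

lemma finite_vertices: "finite (\<Union>F)"
  using con3 by (auto simp: k_connected_def intro: card_ge_0_finite)

lemma extend:
  assumes t: "t \<in> uverts T" "t \<notin> U" and s: "s \<in> U" "adj T s t"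
    and unique: "\<And>s'. s' \<in> U \<Longrightarrow> adj T s' t \<Longrightarrow> s' = s"
  shows "\<exists>F' \<pi>' \<Phi>' c'. realization T v0 (insert t U) D F' \<pi>' \<Phi>' X c'"
proof -
  let ?nb = "\<lambda>U s. {t \<in> uverts T - U. adj T s t}"
  have fin_nb: "finite (?nb U s)" for U s using finT by simp
  have "t \<in> ?nb U s" using t s by simp
  then have "0 < card (?nb U s)" using fin_nb[of U s] card_gt_0_iff by blast
  then have "\<Phi> s \<noteq> {}" using slots_card[OF s(1)] by auto
  then obtain f where f\<Phi>: "f \<in> \<Phi> s" by blast
  then have f: "f \<in> F" using slots_faces s by blast
  have f3: "card f = 3" using tile f by (simp add: tiling_def)
  have card3: "card g = 3" if "g \<in> F" for g using tile that by (simp add: tiling_def)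
  have f\<pi>: "f \<subseteq> \<Union>(\<pi> s)"
    using is_triangle_subset[OF slots_triangle[OF s(1) f\<Phi>]] by simp
  have "\<not> affine_dependent f"
    using simplicial_affine_independent[OF tiling_simplicial[OF tile] f] .
  define n where "n = 3 + card (uverts T)"
  then obtain a b r where w: "wheel_tiling f a b r n"
    using wheel_tiling_exists[OF f3 \<open>\<not> affine_dependent f\<close>, of n] by auto
  define W where "W = wheel a b r n"
  have tW: "tiling f W" and fD: "f = {b, r 0, r n}" and af: "a \<notin> f"
    using w by (auto simp: wheel_tiling_def W_def)
  let ?G = "F - {f} \<union> W"
  note fill = tiling_fill[OF tile f tW]
  have aW: "a \<in> \<Union>W" using n_def by (simp add: W_def wheel_verts)
  have aF: "a \<notin> \<Union>F" using fill(2) aW af by blast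
  have "k_connected 3 (skeleton W)" using wheel_k_connected[OF w] n_def by (simp add: W_def)
  then have con: "k_connected 3 (skeleton ?G)" by (rule k_connected_fill[OF tile f tW con3])
  have sG: "simplicial ?G" "simplicial W" "simplicial F"
    using tiling_simplicial fill(1) tW tile by blast+
  have "\<not> \<Union>F \<subseteq> f"
    using card_mono[OF card_3_finite[OF f3], of "\<Union>F"] con3 f3 by (auto simp: k_connected_def)
  then obtain q where "q \<in> \<Union>F - f" by blast
  then have sepf: "separating_triangle (skeleton ?G) f"
    using separating_fill_new[OF tile f tW] aW af by blast
  have "decomposition (draw W) {draw W}"
    using wheel_no_separating_triangle[OF w] n_def underlying_draw[OF sG(2)]
    by (intro decomposition.piece) (simp add: W_def)
  then have dec: "decomposition (draw ?G) ({draw W} \<union> (\<lambda>t. draw (\<pi> t)) ` U)"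
    using sepf decomp underlying_draw[OF sG(1)] parts_of_fill[OF tile f tW]
    by (intro decomposition.split[of _ f]) simp_all
  define \<pi>' where "\<pi>' = \<pi>(t := W)"
  define \<Phi>' where "\<Phi>' = \<Phi>(s := \<Phi> s - {f}, t := slots a r n)"
  have old: "u \<noteq> t" if "u \<in> U" for u using that t by blast
  have \<pi>'t: "\<pi>' t = W" by (simp add: \<pi>'_def)
  have \<pi>'U: "\<pi>' u = \<pi> u" if "u \<in> U" for u using old[OF that] by (simp add: \<pi>'_def)
  have \<Phi>'t: "\<Phi>' t = slots a r n" by (simp add: \<Phi>'_def)
  have \<Phi>'U: "\<Phi>' u = (if u = s then \<Phi> s - {f} else \<Phi> u)" if "u \<in> U" for u
    using old[OF that] by (simp add: \<Phi>'_def)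
  have f_other: "f \<notin> \<Phi> u" if "u \<in> U" "u \<noteq> s" for u
    using slots_private[OF that(1) s(1) that(2)] f\<pi> by blast
  have \<Phi>'sub: "\<Phi>' u \<subseteq> \<Phi> u - {f}" if "u \<in> U" for u
    using f_other[OF that] \<Phi>'U[OF that] by auto
  obtain d where d: "d \<notin> c ` (\<Union>F - X)"
    using ex_new_if_finite[of "c ` (\<Union>F - X)"] finite_vertices by (auto simp: infinite_UNIV_nat)
  obtain c' where c': "component_labelling (skeleton ?G) X c'" "\<forall>x\<in>\<Union>F. c' x = c x"
    "f \<subseteq> X \<longrightarrow> (\<forall>x\<in>\<Union>W - \<Union>F. c' x = d)"
    using component_labelling_fill[OF tile f tW labels, of d] by metis
  have inter: "S = f" if "S \<subseteq> \<Union>F" "S \<subseteq> \<Union>W" "card S = 3" for S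
    using that fill(2) f3 card_3_finite[OF f3] by (intro card_subset_eq) auto
  have nb_mono: "card (?nb (insert t U) u) \<le> card (?nb U u)" for u
    by (intro card_mono fin_nb) auto
  have nb_s: "Suc (card (?nb (insert t U) s)) = card (?nb U s)"
  proof -
    have "?nb U s = insert t (?nb (insert t U) s)" using t s by auto
    then show ?thesis using fin_nb[of "insert t U" s] by simp
  qed
  have labels_sub: "c ` (\<Union>F - X) \<subseteq> c' ` (\<Union>?G - X)"
  proof
    fix l assume "l \<in> c ` (\<Union>F - X)"
    then obtain x where "x \<in> \<Union>F" "x \<notin> X" "l = c' x" using c'(2) by auto
    then show "l \<in> c' ` (\<Union>?G - X)" using fill(3) by blast
  qed
  have finG: "finite (c' ` (\<Union>?G - X))"
  proof -
    have "0 < card (\<Union>?G)" using con by (simp add: k_connected_def)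
    then have "finite (\<Union>?G)" by (rule card_ge_0_finite)
    then show ?thesis by blast
  qed
  have "realization T v0 (insert t U) D ?G \<pi>' \<Phi>' X c'"
  proof (unfold_locales)
    show "finite (uverts T)" by (rule finT)
    show "v0 \<in> insert t U" using rootU by simp
    show "tiling D ?G" by (rule fill(1))
    show "k_connected 3 (skeleton ?G)" by (rule con)
    show "X \<subseteq> \<Union>?G" using X_subset fill(3) by blast
    show "component_labelling (skeleton ?G) X c'" by (rule c')
    have "(\<lambda>u. draw (\<pi>' u)) ` U = (\<lambda>u. draw (\<pi> u)) ` U" using \<pi>'U by (intro image_cong) auto
    then show "decomposition (draw ?G) ((\<lambda>t. draw (\<pi>' t)) ` insert t U)"
      using dec \<pi>'t by simp
    show "inj_on (\<lambda>t. \<Union>(\<pi>' t)) (insert t U)"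
      unfolding inj_on_insert
    proof
      show "inj_on (\<lambda>t. \<Union>(\<pi>' t)) U" using pieces_inj \<pi>'U by (simp add: inj_on_def)
      show "\<Union>(\<pi>' t) \<notin> (\<lambda>t. \<Union>(\<pi>' t)) ` (U - {t})"
        using \<pi>'t \<pi>'U aW aF pieces_subset by fastforce
    qed
    show "simplicial (\<pi>' u)" if "u \<in> insert t U" for u
      using that pieces_simplicial \<pi>'U \<pi>'t sG(2) by auto
    show "\<Union>(\<pi>' u) \<subseteq> \<Union>?G" if u: "u \<in> insert t U" for u
    proof (cases "u = t")
      case False
      then have "u \<in> U" using u by blast
      then show ?thesis using pieces_subset[of u] \<pi>'U[of u] fill(3) by blast
    qed (use \<pi>'t in blast)
    show "\<exists>S. separating_triangle (skeleton ?G) S \<and> is_triangle (skeleton (\<pi>' u)) S \<and>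
        is_triangle (skeleton (\<pi>' v)) S"
      if u: "u \<in> insert t U" and v: "v \<in> insert t U" and uv: "u \<noteq> v" and adj: "adj T u v" for u v
    proof -
      have new: "is_triangle (skeleton W) f" using tiling_outer_triangle[OF tW] .
      note sl = slots_triangle[OF s(1) f\<Phi>]
      consider "u \<in> U" "v \<in> U" | "u = t" "v \<in> U" | "u \<in> U" "v = t" using u v uv by blast
      then show ?thesis
      proof cases
        case 1
        then show ?thesis
          using pieces_adj[OF 1 uv adj] separating_fill_mono[OF tile f tW] \<pi>'U by auto
      next
        case 2
        then have "v = s" using unique adj adj_commute by metis
        then show ?thesis using sepf sl new 2 \<pi>'t \<pi>'U[OF s(1)] by auto
      next
        case 3
        then have "u = s" using unique adj by blast
        then show ?thesis using sepf sl new 3 \<pi>'t \<pi>'U[OF s(1)] by auto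
      qed
    qed
    show "adj T u v"
      if u: "u \<in> insert t U" and v: "v \<in> insert t U" and uv: "u \<noteq> v"
        and S: "card S = 3" "S \<subseteq> \<Union>(\<pi>' u)" "S \<subseteq> \<Union>(\<pi>' v)" for u v S
    proof -
      have key: "x = s" if x: "x \<in> U" "S \<subseteq> \<Union>(\<pi> x)" "S \<subseteq> \<Union>W" for x
      proof (rule ccontr)
        assume "x \<noteq> s"
        have "S \<subseteq> \<Union>F" using x pieces_subset[of x] by blast
        then have "S = f" using inter x(3) S(1) by blast
        then show False using slots_private[OF s(1) x(1) _ f\<Phi>] \<open>x \<noteq> s\<close> x(2) by auto
      qed
      consider "u \<in> U" "v \<in> U" | "u = t" "v \<in> U" | "u \<in> U" "v = t" using u v uv by blast
      then show ?thesis
      proof cases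
        case 1
        then show ?thesis using pieces_not_adj[OF 1 uv S(1)] S \<pi>'U by simp
      next
        case 2
        then have "v = s" using key S \<pi>'t \<pi>'U by simp
        then show ?thesis using s 2 adj_commute by metis
      next
        case 3
        then have "u = s" using key S \<pi>'t \<pi>'U by simp
        then show ?thesis using s 3 by simp
      qed
    qed
    show "\<Phi>' u \<subseteq> ?G" if u: "u \<in> insert t U" for u
    proof (cases "u = t")
      case True
      then show ?thesis using \<Phi>'t slots_subset_wheel[of a r n b] by (auto simp: W_def)
    next
      case False
      then show ?thesis using \<Phi>'sub[of u] slots_faces[of u] u by blast
    qed
    show "is_triangle (skeleton (\<pi>' u)) g" if u: "u \<in> insert t U" and g: "g \<in> \<Phi>' u" for u g
    proof (cases "u = t")
      case True
      then have "g \<in> W" using g \<Phi>'t slots_subset_wheel[of a r n b] by (auto simp: W_def)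
      then show ?thesis using True \<pi>'t tiling_face_triangle[OF tW] by simp
    next
      case False
      then show ?thesis using \<Phi>'sub[of u] slots_triangle[of u g] u g \<pi>'U[of u] by auto
    qed
    show "\<not> g \<subseteq> \<Union>(\<pi>' v)"
      if u: "u \<in> insert t U" and v: "v \<in> insert t U" and uv: "u \<noteq> v" and g: "g \<in> \<Phi>' u" for u v g
    proof (cases "u = t")
      case True
      then have "a \<in> g" using g \<Phi>'t slot_pole by auto
      moreover have "v \<in> U" using True v uv by blast
      then have "\<Union>(\<pi>' v) \<subseteq> \<Union>F" using \<pi>'U pieces_subset by simp
      ultimately show ?thesis using aF by blast
    next
      case False
      then have uU: "u \<in> U" using u by blast
      then have g': "g \<in> \<Phi> u" "g \<noteq> f" using \<Phi>'sub g by blast+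
      show ?thesis
      proof (cases "v = t")
        case True
        have "g \<in> F" using g' slots_faces uU by blast
        then show ?thesis using inter[of g] g' card3[of g] True \<pi>'t by auto
      next
        case False
        then have "v \<in> U" using v by blast
        then show ?thesis using slots_private[OF uU _ uv g'(1)] \<pi>'U by simp
      qed
    qed
    show "card (?nb (insert t U) u) \<le> card (\<Phi>' u)" if u: "u \<in> insert t U" for u
    proof (cases "u = t")
      case True
      have "card (?nb (insert t U) u) \<le> card (uverts T)" by (intro card_mono finT) auto
      then show ?thesis using True \<Phi>'t card_slots[OF w] n_def by simp
    next
      case False
      then have uU: "u \<in> U" using u by blast
      show ?thesis
      proof (cases "u = s")
        case True
        then have "card (\<Phi>' u) = card (\<Phi> s) - 1"
          using \<Phi>'U[OF uU] f\<Phi> by (simp add: card_Diff_singleton)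
        then show ?thesis using True nb_s slots_card[OF s(1)] by simp
      next
        case False
        then show ?thesis using \<Phi>'U[OF uU] slots_card[OF uU] nb_mono[of u] by simp
      qed
    qed
    show "g \<subseteq> X" if "g \<in> \<Phi>' v0" for g
      using that \<Phi>'sub[OF rootU] slots_root by blast
    show "card X \<le> card (c' ` (\<Union>?G - X)) + card (?nb (insert t U) v0)"
    proof (cases "s = v0")
      case True
      then have "f \<subseteq> X" using slots_root f\<Phi> by simp
      then have "c' a = d" using c'(3) aW aF by blast
      moreover have "a \<in> \<Union>?G - X" using aW aF X_subset fill(3) by blast
      ultimately have "insert d (c ` (\<Union>F - X)) \<subseteq> c' ` (\<Union>?G - X)" using labels_sub by blast
      then have "card (insert d (c ` (\<Union>F - X))) \<le> card (c' ` (\<Union>?G - X))"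
        by (rule card_mono[OF finG])
      then have "Suc (card (c ` (\<Union>F - X))) \<le> card (c' ` (\<Union>?G - X))"
        using d finite_vertices by simp
      then show ?thesis using labels_card nb_s True by simp
    next
      case False
      then have "?nb (insert t U) v0 = ?nb U v0" using unique[OF rootU] by auto
      then show ?thesis using labels_card card_mono[OF finG labels_sub] by simp
    qed
  qed
  then show ?thesis by blast
qed

lemma not_hamiltonian_connected:
  assumes "uverts T \<subseteq> U" "2 \<le> card X"
  shows "\<not> hamiltonian_connected (skeleton F)"
proof
  assume h: "hamiltonian_connected (skeleton F)"
  have "finite X" using X_subset finite_vertices finite_subset by blast
  then obtain u v where uv: "u \<in> X" "v \<in> X" "u \<noteq> v"
    using assms(2) card_le_Suc0_iff_eq[of X] by force
  moreover have "u \<in> \<Union>F" "v \<in> \<Union>F" using uv X_subset by blast+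
  ultimately obtain p where "vpath (skeleton F) u p v" "set p = uverts (skeleton F)"
    using h unfolding hamiltonian_connected_def uverts_skeleton by metis
  then have "card (c ` (\<Union>F - X)) < card X"
    using too_many_components[OF labels _ _ uv(1,2)] X_subset by simp
  moreover have nb: "{t \<in> uverts T - U. adj T v0 t} = {}" using assms(1) by auto
  ultimately show False using labels_card unfolding nb by simp
qed

lemma has_decomposition_tree:
  assumes T: "simple_graph T" and U: "U = uverts T"
  shows "has_decomposition_tree (draw F) T"
proof -
  let ?g = "\<lambda>t. draw (\<pi> t)"
  let ?P = "?g ` U"
  have inj: "inj_on ?g U"
    using pieces_inj by (auto simp: inj_on_def draw_def)
  define h where "h = inv_into U ?g"
  have hg: "h (?g t) = t" if "t \<in> U" for t unfolding h_def using inv_into_f_f[OF inj that] .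
  have uF: "underlying (draw F) = skeleton F" using underlying_draw tiling_simplicial[OF tile] by blast
  have ug: "underlying (?g t) = skeleton (\<pi> t)" if "t \<in> U" for t
    using underlying_draw pieces_simplicial[OF that] by blast
  have edge: "(\<exists>S. separating_triangle (skeleton F) S \<and> is_triangle (skeleton (\<pi> s)) S \<and>
      is_triangle (skeleton (\<pi> t)) S) \<longleftrightarrow> adj T s t" if st: "s \<in> U" "t \<in> U" "s \<noteq> t" for s t
  proof
    assume "\<exists>S. separating_triangle (skeleton F) S \<and> is_triangle (skeleton (\<pi> s)) S \<and>
      is_triangle (skeleton (\<pi> t)) S"
    then obtain S where S: "is_triangle (skeleton (\<pi> s)) S" "is_triangle (skeleton (\<pi> t)) S" by blast
    then have "card S = 3" "S \<subseteq> \<Union>(\<pi> s)" "S \<subseteq> \<Union>(\<pi> t)"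
      using is_triangle_subset[OF S(1)] is_triangle_subset[OF S(2)] by (simp_all add: is_triangle_skeleton)
    then show "adj T s t" using pieces_not_adj[OF st] by blast
  qed (use pieces_adj[OF st] in blast)
  have "bij_betw h (uverts (piece_graph (draw F) ?P)) (uverts T)"
    using bij_betw_inv_into[OF bij_betw_imageI[OF inj refl]] U by (simp add: h_def piece_graph_def)
  moreover have "uedges T = (`) h ` uedges (piece_graph (draw F) ?P)"
  proof (intro subset_antisym subsetI)
    fix e assume e: "e \<in> uedges T"
    then obtain s t where st: "e = {s, t}" "s \<noteq> t" "s \<in> U" "t \<in> U"
      using T U by (auto simp: simple_graph_def card_2_iff)
    then have "?g s \<noteq> ?g t" using inj by (auto simp: inj_on_def)
    moreover have "adj T s t" using e st by (simp add: adj_def)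
    then obtain S where "separating_triangle (underlying (draw F)) S"
      "is_triangle (underlying (?g s)) S" "is_triangle (underlying (?g t)) S"
      using edge[OF st(3,4,2)] ug[OF st(3)] ug[OF st(4)] uF by auto
    ultimately have "{?g s, ?g t} \<in> uedges (piece_graph (draw F) ?P)"
      using st(3,4) unfolding piece_graph_def ugraph.simps mem_Collect_eq by blast
    moreover have "h ` {?g s, ?g t} = e" using hg st by simp
    ultimately show "e \<in> (`) h ` uedges (piece_graph (draw F) ?P)" by (metis imageI)
  next
    fix e assume "e \<in> (`) h ` uedges (piece_graph (draw F) ?P)"
    then obtain s t S where st: "s \<in> U" "t \<in> U" "?g s \<noteq> ?g t" "e = h ` {?g s, ?g t}"
      "separating_triangle (underlying (draw F)) S" "is_triangle (underlying (?g s)) S"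
      "is_triangle (underlying (?g t)) S"
      by (auto simp: piece_graph_def)
    then have "adj T s t" using edge[of s t] ug uF by auto
    moreover have "e = {s, t}" using st hg by simp
    ultimately show "e \<in> uedges T" by (simp add: adj_def)
  qed
  ultimately have "graph_iso (piece_graph (draw F) ?P) T"
    unfolding graph_iso_def by blast
  then show ?thesis using decomp unfolding has_decomposition_tree_def by blast
qed

end

lemma realization_root:
  assumes fin: "finite (uverts T)" and v0: "v0 \<in> uverts T"
    and d: "4 \<le> card {t \<in> uverts T - {v0}. adj T v0 t}"
  shows "\<exists>D F \<pi> \<Phi> X c. realization T v0 {v0} D F \<pi> \<Phi> X c \<and> 2 \<le> card X"
proof -
  define n where "n = card {t \<in> uverts T - {v0}. adj T v0 t} - 1"
  have n: "3 \<le> n" "card {t \<in> uverts T - {v0}. adj T v0 t} = Suc n" using d by (auto simp: n_def)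
  define D where "D = {0, 1, \<i>}"
  have D3: "card D = 3" by (simp add: D_def complex_eq_iff)
  have "\<not> collinear D"
    unfolding D_def collinear_lemma by (auto simp: complex_eq_iff)
  then have "\<not> affine_dependent D"
    unfolding D_def using collinear_3_eq_affine_dependent by blast
  then obtain a b r where w: "wheel_tiling D a b r n"
    using wheel_tiling_exists[OF D3, of n] n by auto
  define W where "W = wheel a b r n"
  have tW: "tiling D W" and inj: "inj_on r {..n}" and ab: "a \<notin> r ` {..n}" "b \<notin> r ` {..n}" "a \<noteq> b"
    using w by (auto simp: wheel_tiling_def W_def)
  have V: "\<Union>W = {a, b} \<union> r ` {..n}" unfolding W_def using n by (intro wheel_verts) simp
  define X where "X = insert a (r ` {..n})"
  have cX: "card X = n + 2" using ab inj by (simp add: X_def card_image)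
  have VX: "\<Union>W - X = {b}" using V ab by (auto simp: X_def)
  have sW: "simplicial W" using tiling_simplicial[OF tW] .
  have "realization T v0 {v0} D W (\<lambda>_. W) (\<lambda>_. slots a r n) X (\<lambda>_. 0)"
  proof (unfold_locales)
    show "k_connected 3 (skeleton W)" using wheel_k_connected[OF w] n by (simp add: W_def)
    show "decomposition (draw W) ((\<lambda>t. draw W) ` {v0})"
      using wheel_no_separating_triangle[OF w n(1)] underlying_draw[OF sW]
      by (auto intro!: decomposition.piece simp: W_def)
    show "slots a r n \<subseteq> W" by (simp add: W_def slots_subset_wheel)
    show "is_triangle (skeleton W) f" if "f \<in> slots a r n" for f
      using that slots_subset_wheel[of a r n b] tiling_face_triangle[OF tW] by (auto simp: W_def)
    show "card {t \<in> uverts T - {v0}. adj T s t} \<le> card (slots a r n)" if "s \<in> {v0}" for s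
      using that n card_slots[OF w] by simp
    show "X \<subseteq> \<Union>W" using V by (auto simp: X_def)
    show "component_labelling (skeleton W) X (\<lambda>_. 0::nat)" by (simp add: component_labelling_def)
    show "card X \<le> card ((\<lambda>_. 0::nat) ` (\<Union>W - X)) + card {t \<in> uverts T - {v0}. adj T v0 t}"
      using cX VX n by simp
    show "f \<subseteq> X" if "f \<in> slots a r n" for f using slot_subset[OF that] by (simp add: X_def)
  qed (use fin tW sW in auto)
  then show ?thesis using cX by (metis le_add2)
qed

lemma tree_unique_attachment:
  assumes T: "\<nexists>p. vcycle T p" and t: "t \<in> uverts T" "t \<notin> U"
    and U: "graph_connected (del_verts T (- U))" "U \<subseteq> uverts T"
    and s: "s \<in> U" "adj T s t" and s': "s' \<in> U" "adj T s' t"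
  shows "s' = s"
proof (rule ccontr)
  assume "s' \<noteq> s"
  obtain p where p: "vpath (del_verts T (- U)) s p s'"
    using U s s' unfolding graph_connected_def uverts_del_verts by blast
  have succ: "successively (adj T) p"
    using p unfolding vpath_def by (auto intro: successively_mono)
  have sub: "set p \<subseteq> U" using p by (auto simp: vpath_def)
  have hl: "p \<noteq> []" "hd p = s" "last p = s'" "distinct p" using p by (auto simp: vpath_def)
  then have "2 \<le> length p" using \<open>s' \<noteq> s\<close>
    by (cases p rule: remdups_adj.cases) auto
  then have "vcycle T (t # p)"
    using succ sub hl t U(2) s(2) s'(2) adj_commute[of T s t]
    by (auto simp: vcycle_def successively_Cons)
  then show False using T by blast
qed

lemma tree_growth:
  assumes T: "is_tree T" and v0: "v0 \<in> uverts T"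
    and base: "P {v0}"
    and step: "\<And>U s t. P U \<Longrightarrow> t \<in> uverts T \<Longrightarrow> t \<notin> U \<Longrightarrow> s \<in> U \<Longrightarrow> adj T s t \<Longrightarrow>
      (\<And>s'. s' \<in> U \<Longrightarrow> adj T s' t \<Longrightarrow> s' = s) \<Longrightarrow> P (insert t U)"
  shows "P (uverts T)"
proof -
  let ?H = "\<lambda>U. del_verts T (- U)"
  have fin: "finite (uverts T)" and E: "\<forall>e\<in>uedges T. e \<subseteq> uverts T"
    and con: "graph_connected T" and acyc: "\<nexists>p. vcycle T p"
    using T by (auto simp: is_tree_def simple_graph_def)
  define ok where "ok = (\<lambda>U. P U \<and> v0 \<in> U \<and> U \<subseteq> uverts T \<and> (\<forall>x\<in>U. (adj (?H U))\<^sup>*\<^sup>* v0 x))"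
  have EH: "\<forall>e\<in>uedges (?H U). e \<subseteq> uverts (?H U)" for U
    using E by (auto simp: del_verts_def)
  have grow: "\<exists>t\<in>uverts T - U. ok (insert t U)" if U: "ok U" "U \<noteq> uverts T" for U
  proof -
    have okU: "P U" "v0 \<in> U" "U \<subseteq> uverts T" "\<forall>x\<in>U. (adj (?H U))\<^sup>*\<^sup>* v0 x"
      using U by (auto simp: ok_def)
    obtain y where y: "y \<in> uverts T" "y \<notin> U" using okU U by blast
    have "(adj T)\<^sup>*\<^sup>* v0 y" using con v0 y unfolding graph_connected_iff[OF E] by blast
    then have "y \<notin> U \<longrightarrow> (\<exists>s\<in>U. \<exists>t. t \<notin> U \<and> adj T s t)"
      by (induction rule: rtranclp_induct) (use okU in auto)
    then obtain s t where st: "s \<in> U" "t \<notin> U" "adj T s t" using y by blast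
    have tV: "t \<in> uverts T" using st E by (auto simp: adj_def)
    have "graph_connected (?H U)"
      using okU by (intro graph_connected_hub[where h = v0, OF EH]) auto
    then have un: "s' = s" if "s' \<in> U" "adj T s' t" for s'
      using tree_unique_attachment[OF acyc tV st(2) _ okU(3) st(1,3)] that by blast
    have "P (insert t U)" using step[OF okU(1) tV st(2,1,3) un] .
    moreover have reach: "(adj (?H (insert t U)))\<^sup>*\<^sup>* v0 x" if "x \<in> U" for x
      using okU(4) that by (auto intro: rtranclp_adj_mono[of "?H U"])
    moreover have "(adj (?H (insert t U)))\<^sup>*\<^sup>* v0 t"
      using reach[OF st(1)] st by (auto intro: rtranclp.rtrancl_into_rtrancl)
    ultimately have "ok (insert t U)" using okU tV by (auto simp: ok_def)
    then show ?thesis using tV st by blast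
  qed
  have "\<exists>U. ok U \<and> Suc k \<le> card U" if "Suc k \<le> card (uverts T)" for k
    using that
  proof (induction k)
    case 0
    have "ok {v0}" using base v0 by (auto simp: ok_def)
    then show ?case by (intro exI[of _ "{v0}"]) simp
  next
    case (Suc k)
    then obtain U where U: "ok U" "Suc k \<le> card U" by auto
    show ?case
    proof (cases "U = uverts T")
      case True
      then show ?thesis using U Suc by auto
    next
      case False
      then obtain t where t: "t \<in> uverts T - U" "ok (insert t U)" using grow U by blast
      have "finite U" using U fin by (auto simp: ok_def intro: finite_subset)
      then have "Suc (Suc k) \<le> card (insert t U)" using t U by simp
      then show ?thesis using t by blast
    qed
  qed
  moreover have "0 < card (uverts T)" using fin v0 card_gt_0_iff by blast
  ultimately obtain U where U: "ok U" "card (uverts T) \<le> card U"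
    by (metis Suc_pred' order_refl)
  then have "U = uverts T" using fin by (intro card_seteq) (auto simp: ok_def)
  then show ?thesis using U by (simp add: ok_def)
qed

lemma vdegree_eq_card_neighbours:
  assumes T: "simple_graph T"
  shows "vdegree T v = card {t \<in> uverts T - {v}. adj T v t}"
proof -
  have "bij_betw (\<lambda>t. {v, t}) {t \<in> uverts T - {v}. adj T v t} {e \<in> uedges T. v \<in> e}"
  proof (rule bij_betw_imageI)
    show "inj_on (\<lambda>t. {v, t}) {t \<in> uverts T - {v}. adj T v t}"
      by (auto simp: inj_on_def doubleton_eq_iff)
    show "(\<lambda>t. {v, t}) ` {t \<in> uverts T - {v}. adj T v t} = {e \<in> uedges T. v \<in> e}"
    proof (intro subset_antisym subsetI)
      fix e assume e: "e \<in> {e \<in> uedges T. v \<in> e}"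
      then have "e \<subseteq> uverts T" "card e = 2" using T by (auto simp: simple_graph_def)
      moreover from this obtain x y where xy: "e = {x, y}" "x \<noteq> y" by (meson card_2_iff)
      moreover have "v = x \<or> v = y" using e xy by blast
      ultimately obtain t where "t \<in> uverts T" "t \<noteq> v" "e = {v, t}" by blast
      then show "e \<in> (\<lambda>t. {v, t}) ` {t \<in> uverts T - {v}. adj T v t}" using e by (auto simp: adj_def)
    qed (auto simp: adj_def)
  qed
  then show ?thesis unfolding vdegree_def by (rule bij_betw_same_card[symmetric])
qed

theorem theorem3:
  fixes T :: "'a ugraph"
  assumes "is_tree T" and "max_degree T > 3"
  shows "\<exists>G. plane_triangulation G \<and> k_connected 3 (underlying G) \<and>
             has_decomposition_tree G T \<and> \<not> hamiltonian_connected (underlying G)"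
proof -
  have T: "simple_graph T" "finite (uverts T)" "uverts T \<noteq> {}"
    using assms by (auto simp: is_tree_def simple_graph_def)
  then have "max_degree T \<in> vdegree T ` uverts T"
    unfolding max_degree_def by (intro Max_in) auto
  then obtain v0 where v0: "v0 \<in> uverts T" "4 \<le> vdegree T v0" using assms by auto
  define P where "P = (\<lambda>U. \<exists>D F \<pi> \<Phi> X c. realization T v0 U D F \<pi> \<Phi> X c \<and> 2 \<le> card X)"
  have "P (uverts T)"
  proof (rule tree_growth[OF assms(1) v0(1)])
    show "P {v0}"
      unfolding P_def using realization_root[OF T(2) v0(1)] v0(2) vdegree_eq_card_neighbours[OF T(1)]
      by simp
    show "P (insert t U)" if "P U" "t \<in> uverts T" "t \<notin> U" "s \<in> U" "adj T s t"
      "\<And>s'. s' \<in> U \<Longrightarrow> adj T s' t \<Longrightarrow> s' = s" for U s t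
      using that(1) realization.extend[OF _ that(2-6)] unfolding P_def by meson
  qed
  then obtain D F \<pi> \<Phi> X c where R: "realization T v0 (uverts T) D F \<pi> \<Phi> X c" "2 \<le> card X"
    by (auto simp: P_def)
  interpret realization T v0 "uverts T" D F \<pi> \<Phi> X c by (rule R(1))
  have "underlying (draw F) = skeleton F"
    using underlying_draw tiling_simplicial[OF tile] by blast
  then show ?thesis
    using plane_triangulation_draw[OF tile] con3 has_decomposition_tree[OF T(1) refl]
      not_hamiltonian_connected[OF subset_refl R(2)]
    by (intro exI[of _ "draw F"]) simp
qed

end
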